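(* Let $f,g \in \mathbb{K}(\!\langle X\rangle\!)$ be given by the minimal admissible linear systems $\mathcal{A}_f = (u_f, A_f, v_f)$ and $\mathcal{A}_g = (u_g, A_g, v_g)$, respectively, both of dimension $n$. Then $f = g$ if and only if there exist matrices $T,U \in \mathbb{K}^{n\times n}$ such that $$u_f U = 0,\qquad T A_g - A_f U = A_f u_f^{\top} u_g \qquad\text{and}\qquad T v_g = v_f.$$
   Context: $\mathbb{K}$ is a commutative field, $X=\{x_1,\ldots,x_d\}$ a finite alphabet, $\mathbb{K}\langle X\rangle$ the free associative algebra (non-commutative polynomials) and $\mathbb{K}(\!\langle X\rangle\!)$ its universal field of fractions in the sense of Cohn (the free field). A square matrix $A\in\mathbb{K}\langle X\rangle^{n\times n}$ is full if it cannot be written as $A=TU$ with $T\in\mathbb{K}\langle X\rangle^{n\times m}$, $U\in\mathbb{K}\langle X\rangle^{m\times n}$ and $m<n$; equivalently, $A$ is invertible over the free field. A linear representation of $f\in\mathbb{K}(\!\langle X\rangle\!)$ is a triple $(u,A,v)$ with $u\in\mathbb{K}^{1\times n}$, $v\in\mathbb{K}^{n\times 1}$, and $A=A_0\otimes 1+A_1\otimes x_1+\cdots+A_d\otimes x_d$ with $A_\ell\in\mathbb{K}^{n\times n}$ such that $A$ is full and $f=uA^{-1}v$; its dimension is $n$. It is minimal if its dimension is the smallest among all linear representations of $f$. An admissible linear system (ALS) for $f$ is a linear representation $(u,A,v)$ of $f$ with $u=e_1=[1,0,\ldots,0]$. *)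

theory Defs
  imports
    "Jordan_Normal_Form.Matrix"
    "Jordan_Normal_Form.VS_Connect"
    "HOL-Library.Poly_Mapping"
    "HOL-Algebra.Subrings"
begin

section \<open>The free associative algebra\<close>

text \<open>Words under concatenation form the free monoid. It is written additively because
  the convolution product of \<^typ>\<open>'a \<Rightarrow>\<^sub>0 'b\<close> is set up for additive (not necessarily
  commutative) monoids of exponents.\<close>

instantiation list :: (type) monoid_add
begin

definition zero_list :: "'a list" where "zero_list = []"

definition plus_list :: "'a list \<Rightarrow> 'a list \<Rightarrow> 'a list" where "plus_list xs ys = xs @ ys"

instance by standard (simp_all add: zero_list_def plus_list_def)

end

type_synonym ('k, 'x) free_algebra = "'x list \<Rightarrow>\<^sub>0 'k"

definition const :: "'k \<Rightarrow> ('k::field, 'x) free_algebra" where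
  "const c = Poly_Mapping.single [] c"

definition letter :: "'x \<Rightarrow> ('k::field, 'x) free_algebra" where
  "letter x = Poly_Mapping.single [x] 1"

abbreviation const_mat :: "'k mat \<Rightarrow> ('k::field, 'x) free_algebra mat" where
  "const_mat \<equiv> map_mat const"

definition full_mat :: "'r::semiring_0 mat \<Rightarrow> bool" where
  "full_mat A \<longleftrightarrow> square_mat A \<and>
     \<not> (\<exists>m < dim_row A. \<exists>T \<in> carrier_mat (dim_row A) m. \<exists>U \<in> carrier_mat m (dim_row A). A = T * U)"

section \<open>The free field\<close>

definition skew_field :: "'l ring \<Rightarrow> bool" where
  "skew_field L \<longleftrightarrow> Ring.ring L \<and> \<one>\<^bsub>L\<^esub> \<noteq> \<zero>\<^bsub>L\<^esub> \<and> Units L = carrier L - {\<zero>\<^bsub>L\<^esub>}"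

text \<open>An epic \<open>R\<close>-field is a skew field \<open>L\<close> with a ring homomorphism \<open>R \<rightarrow> L\<close> whose image
  generates \<open>L\<close> as a skew field. The structure \<^const>\<open>class_ring\<close> is the ring of a type class
  instance, with carrier \<^const>\<open>UNIV\<close>.\<close>

definition epic_field :: "('r::ring_1 \<Rightarrow> 'l) \<Rightarrow> 'l ring \<Rightarrow> bool" where
  "epic_field \<phi> L \<longleftrightarrow> skew_field L \<and> \<phi> \<in> Ring.ring_hom class_ring L \<and>
     (\<forall>S. subring S L \<and> range \<phi> \<subseteq> S \<and> (\<forall>s \<in> S - {\<zero>\<^bsub>L\<^esub>}. inv\<^bsub>L\<^esub> s \<in> S)
        \<longrightarrow> S = carrier L)"

text \<open>A specialization of \<open>R\<close>-fields, from \<open>\<iota> : R \<rightarrow> D\<close> to \<open>\<phi> : R \<rightarrow> L\<close>, is a homomorphism of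
  \<open>R\<close>-rings \<open>\<psi> : D\<^sub>0 \<rightarrow> L\<close> that is defined on a subring \<open>D\<^sub>0\<close> of \<open>D\<close> containing the image of \<open>R\<close>
  and is local: elements of \<open>D\<^sub>0\<close> outside the kernel are invertible in \<open>D\<^sub>0\<close>.\<close>

definition specialization ::
  "('r::ring_1 \<Rightarrow> 'f::division_ring) \<Rightarrow> ('r \<Rightarrow> 'l) \<Rightarrow> 'l ring \<Rightarrow> 'f set \<Rightarrow> ('f \<Rightarrow> 'l) \<Rightarrow> bool" where
  "specialization \<iota> \<phi> L D\<^sub>0 \<psi> \<longleftrightarrow>
     subring D\<^sub>0 class_ring \<and> range \<iota> \<subseteq> D\<^sub>0 \<and>
     \<psi> \<in> Ring.ring_hom (class_ring\<lparr>carrier := D\<^sub>0\<rparr>) L \<and> (\<forall>r. \<psi> (\<iota> r) = \<phi> r) \<and>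
     (\<forall>a \<in> D\<^sub>0. \<psi> a \<noteq> \<zero>\<^bsub>L\<^esub> \<longrightarrow> inverse a \<in> D\<^sub>0)"

text \<open>Cohn's universal field of fractions: an epic field of fractions that specializes to every
  epic \<open>R\<close>-field. It loses nothing to take the latter with carriers inside the type of \<open>R\<close>
  itself: \<open>R\<close> is infinite here, and an epic \<open>R\<close>-field, being generated by the image of \<open>R\<close>, has at
  most as many elements as \<open>R\<close>. Uniqueness of the specialization (up to restriction to a smaller
  domain) is automatic, since two of them agree on the set where they coincide, which is again
  the domain of a specialization.\<close>

definition universal_field_of_fractions ::
  "(('k::field, 'x) free_algebra \<Rightarrow> 'f::division_ring) \<Rightarrow> bool" where
  "universal_field_of_fractions \<iota> \<longleftrightarrow> inj \<iota> \<and> epic_field \<iota> class_ring \<and>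
     (\<forall>(L :: ('k, 'x) free_algebra ring) \<phi>.
        epic_field \<phi> L \<longrightarrow> (\<exists>D\<^sub>0 \<psi>. specialization \<iota> \<phi> L D\<^sub>0 \<psi>))"

text \<open>Cohn: the free algebra has a universal field of fractions over which exactly the full
  matrices are invertible. Non-full matrices are singular over every skew field; invertibility of
  the full ones, which follows from universality by a theorem of Cohn, is what gives meaning to
  \<open>u A\<^sup>-\<^sup>1 v\<close> for full \<open>A\<close>, so it is recorded as part of the notion.\<close>

definition free_field :: "(('k::field, 'x) free_algebra \<Rightarrow> 'f::division_ring) \<Rightarrow> bool" where
  "free_field \<iota> \<longleftrightarrow> universal_field_of_fractions \<iota> \<and>
     (\<forall>A. square_mat A \<longrightarrow> (full_mat A \<longleftrightarrow> invertible_mat (map_mat \<iota> A)))"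

section \<open>Linear representations\<close>

text \<open>\<open>A = A\<^sub>0 \<otimes> 1 + \<Sum>\<^sub>x A\<^sub>x \<otimes> x\<close>\<close>

definition linear_pencil :: "nat \<Rightarrow> ('k::field, 'x::finite) free_algebra mat \<Rightarrow> bool" where
  "linear_pencil n A \<longleftrightarrow> A \<in> carrier_mat n n \<and>
     (\<exists>A\<^sub>0 \<in> carrier_mat n n. \<exists>A\<^sub>1. (\<forall>x. A\<^sub>1 x \<in> carrier_mat n n) \<and>
        (\<forall>i < n. \<forall>j < n. A $$ (i, j) =
           const (A\<^sub>0 $$ (i, j)) + (\<Sum>x \<in> UNIV. const (A\<^sub>1 x $$ (i, j)) * letter x)))"

text \<open>The vectors \<open>u\<close> and \<open>v\<close> are matrices of sizes \<open>1 \<times> n\<close> and \<open>n \<times> 1\<close>. Dimension \<open>n = 0\<close> is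
  allowed: the empty system is the minimal linear representation of \<open>0\<close>.\<close>

definition linear_representation ::
  "(('k::field, 'x::finite) free_algebra \<Rightarrow> 'f::division_ring) \<Rightarrow> 'f \<Rightarrow> nat
    \<Rightarrow> 'k mat \<Rightarrow> ('k, 'x) free_algebra mat \<Rightarrow> 'k mat \<Rightarrow> bool" where
  "linear_representation \<iota> f n u A v \<longleftrightarrow>
     u \<in> carrier_mat 1 n \<and> v \<in> carrier_mat n 1 \<and> linear_pencil n A \<and> full_mat A \<and>
     (\<exists>B \<in> carrier_mat n n. inverts_mat (map_mat \<iota> A) B \<and> inverts_mat B (map_mat \<iota> A) \<and>
        f = (map_mat \<iota> (const_mat u) * B * map_mat \<iota> (const_mat v)) $$ (0, 0))"

definition minimal_linear_representation ::
  "(('k::field, 'x::finite) free_algebra \<Rightarrow> 'f::division_ring) \<Rightarrow> 'f \<Rightarrow> nat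
    \<Rightarrow> 'k mat \<Rightarrow> ('k, 'x) free_algebra mat \<Rightarrow> 'k mat \<Rightarrow> bool" where
  "minimal_linear_representation \<iota> f n u A v \<longleftrightarrow> linear_representation \<iota> f n u A v \<and>
     (\<forall>m u' A' v'. linear_representation \<iota> f m u' A' v' \<longrightarrow> n \<le> m)"

definition e1_row :: "nat \<Rightarrow> 'k::field mat" where
  "e1_row n = mat 1 n (\<lambda>(i, j). if j = 0 then 1 else 0)"

definition minimal_als ::
  "(('k::field, 'x::finite) free_algebra \<Rightarrow> 'f::division_ring) \<Rightarrow> 'f \<Rightarrow> nat
    \<Rightarrow> 'k mat \<Rightarrow> ('k, 'x) free_algebra mat \<Rightarrow> 'k mat \<Rightarrow> bool" where
  "minimal_als \<iota> f n u A v \<longleftrightarrow> minimal_linear_representation \<iota> f n u A v \<and> u = e1_row n"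

end

theory Submission
  imports Defs "HOL-Library.Function_Algebras" "Jordan_Normal_Form.Determinant"
begin

text \<open>
Call a pair of scalar matrices \<open>T\<close>, \<open>Q\<close> with \<open>T A\<^sub>g = A\<^sub>f Q\<close>, \<open>u\<^sub>f Q = u\<^sub>g\<close> and \<open>T v\<^sub>g = v\<^sub>f\<close> a morphism of linear representations.
The conditions on \<open>T\<close> and \<open>U\<close> in the theorem say exactly that \<open>T\<close> and \<open>Q = U + u\<^sub>f\<^sup>T u\<^sub>g\<close> form a morphism. If a
morphism exists, the represented elements agree by a direct computation over the free field (\<open>morphism_imp_eq\<close>). The
content of the theorem is that minimal representations of the same element are related by a
morphism (\<open>minimal_representations_morphism\<close>).

The difference of the two representations is a representation \<open>(u, A, v)\<close> of zero of dimension \<open>2 n\<close>. So the bordered matrix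
\<open>[[A, v], [u, 0]]\<close> is singular over the free field, and hence not full: it is a product with middle dimension at
most \<open>2 n\<close>. The matrix is linear, and the weak algorithm of the free algebra
(\<open>factorization_degree_reduction\<close>) permits to choose the factors so that no cancellation of degrees occurs. The constant columns
of the left factor and the constant rows of the right factor then yield spaces \<open>L\<close> of scalar rows and \<open>R\<close> of scalar
columns with \<open>L A R = 0\<close>, \<open>L v = 0\<close>, \<open>u R = 0\<close>, and total dimension at least \<open>2 n\<close> (\<open>zero_representation\<close>).

A space \<open>L\<close> of rows and a space \<open>R\<close> of columns with \<open>L A R = 0\<close> amount to a block of zeros in \<open>A\<close> after a scalar base change.
If \<open>A\<close> is full of size \<open>n\<close>, their dimensions add up to at most \<open>n\<close>; and if they add up to \<open>n\<close>, and \<open>L v = 0\<close> or \<open>u R = 0\<close>, then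
the block of zeros decouples the system and leaves a representation of dimension \<open>dim R\<close> or \<open>dim L\<close>
(\<open>reduce_representation\<close>). Applied to the two diagonal blocks of the pencil, these facts and minimality force \<open>L\<close> to
project onto all rows of the first system and \<open>R\<close> onto all columns of the second. The other components of
preimages of the unit vectors are the rows of \<open>T\<close> and the columns of \<open>-Q\<close>.
\<close>

section \<open>Coefficients in the free algebra\<close>

abbreviation wcoeff :: "('k::field, 'x) free_algebra \<Rightarrow> 'x list \<Rightarrow> 'k" where
  "wcoeff \<equiv> Poly_Mapping.lookup"

lemma lookup_times_splits:
  fixes a b :: "('k::field, 'x) free_algebra"
  shows "wcoeff (a * b) w = (\<Sum>i\<le>length w. wcoeff a (take i w) * wcoeff b (drop i w))"
proof -
  let ?S = "(\<lambda>i. take i w) ` {..length w}"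
  have inner: "Sum_any (\<lambda>q. wcoeff b q when w = l + q) =
      (if l \<in> ?S then wcoeff b (drop (length l) w) else 0)" for l
  proof (cases "l \<in> ?S")
    case True
    then obtain i where i: "i \<le> length w" "l = take i w" by auto
    have "(w = l + q) \<longleftrightarrow> (q = drop (length l) w)" for q
      using i by (metis append_eq_conv_conj append_take_drop_id length_take min.absorb2 plus_list_def)
    then show ?thesis using True by (simp add: when_def)
  next
    case False
    have "w \<noteq> l + q" for q
    proof
      assume w: "w = l + q"
      then have "l = take (length l) w" "length l \<le> length w" by (auto simp: plus_list_def)
      with False show False by blast
    qed
    then show ?thesis using False by simp
  qed
  have inj: "inj_on (\<lambda>i. take i w) {..length w}"
    by (auto simp: inj_on_def) (metis length_take min.absorb2)
  have "wcoeff (a * b) w = Sum_any (\<lambda>l. wcoeff a l * (if l \<in> ?S then wcoeff b (drop (length l) w) else 0))"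
    by (simp add: lookup_mult inner)
  also have "\<dots> = (\<Sum>l\<in>?S. wcoeff a l * (if l \<in> ?S then wcoeff b (drop (length l) w) else 0))"
    by (rule Sum_any.expand_superset) auto
  also have "\<dots> = (\<Sum>i\<le>length w. wcoeff a (take i w) * wcoeff b (drop i w))"
    by (subst sum.reindex[OF inj]) (auto intro!: sum.cong simp: min_def)
  finally show ?thesis .
qed

lemma lookup_times_const:
  fixes a :: "('k::field, 'x) free_algebra"
  shows "wcoeff (a * const c) w = wcoeff a w * c"
proof -
  have "wcoeff (a * const c) w = (\<Sum>i\<le>length w. if i = length w then wcoeff a w * c else 0)"
    unfolding lookup_times_splits
    by (rule sum.cong) (auto simp: const_def lookup_single when_def)
  then show ?thesis by simp
qed

lemma lookup_const_times:
  fixes a :: "('k::field, 'x) free_algebra"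
  shows "wcoeff (const c * a) w = c * wcoeff a w"
proof -
  have "wcoeff (const c * a) w = (\<Sum>i\<le>length w. if i = 0 then c * wcoeff a w else 0)"
    unfolding lookup_times_splits
    by (rule sum.cong) (auto simp: const_def lookup_single when_def)
  then show ?thesis by simp
qed

lemma const_1: "const 1 = 1"
  by (simp add: const_def zero_list_def[symmetric])

lemma const_0: "const 0 = 0"
  by (simp add: const_def)

lemma const_add: "const (a + b) = const a + const b"
  by (simp add: const_def single_add)

lemma const_mult: "const (a * b) = const a * const b"
  by (rule poly_mapping_eqI) (simp add: lookup_const_times, simp add: const_def lookup_single when_def)

section \<open>The weak algorithm\<close>

text \<open>Right division by the word \<open>w\<close>, with the remainder discarded.\<close>

definition strip_suffix :: "'x list \<Rightarrow> ('k::field, 'x) free_algebra \<Rightarrow> ('k, 'x) free_algebra" where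
  "strip_suffix w = Poly_Mapping.map_key (\<lambda>y. y @ w)"

lemma lookup_strip_suffix: "wcoeff (strip_suffix w a) y = wcoeff a (y @ w)"
  by (simp add: strip_suffix_def Poly_Mapping.map_key.rep_eq inj_def)

text \<open>This is the weak algorithm of the free algebra, applied to the columns \<open>p j\<close> of the left factor.
The number \<open>s j\<close> exceeds the degree of column \<open>j\<close>, where a row \<open>i\<close> counts with the extra degree \<open>\<alpha> i\<close>
and a column \<open>k\<close> of the product with \<open>\<beta> k\<close>. If a term of \<open>p j i * q j k\<close> may exceed the degree of the product, then the
leading parts of the columns are right linearly dependent. Dividing the dependence relation on the right by a
suitable word turns one coefficient into a scalar, so that the leading part of one column is a combination of the
leading parts of columns of at most the same degree. An elementary operation then lowers the degree of that column.
The process ends because the sum of the \<open>s j\<close> decreases.\<close>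

lemma factorization_degree_reduction:
  fixes p :: "'j \<Rightarrow> 'i \<Rightarrow> ('k::field, 'x) free_algebra" and q :: "'j \<Rightarrow> 'l \<Rightarrow> ('k, 'x) free_algebra"
    and \<alpha> :: "'i \<Rightarrow> nat" and \<beta> :: "'l \<Rightarrow> nat"
  assumes "finite J"
    and "\<forall>j\<in>J. \<forall>i\<in>I. \<forall>u. wcoeff (p j i) u \<noteq> 0 \<longrightarrow> length u + \<alpha> i < s j"
    and "\<forall>i\<in>I. \<forall>k\<in>C. \<forall>w. wcoeff (\<Sum>j\<in>J. p j i * q j k) w \<noteq> 0 \<longrightarrow> length w + \<alpha> i + \<beta> k \<le> 1"
  shows "\<exists>p' q' s'. (\<forall>j\<in>J. \<forall>i\<in>I. \<forall>u. wcoeff (p' j i) u \<noteq> 0 \<longrightarrow> length u + \<alpha> i < s' j)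
    \<and> (\<forall>j\<in>J. \<forall>k\<in>C. \<forall>w. wcoeff (q' j k) w \<noteq> 0 \<and> 0 < s' j \<longrightarrow> s' j + length w + \<beta> k \<le> 2)
    \<and> (\<forall>i\<in>I. \<forall>k\<in>C. (\<Sum>j\<in>J. p' j i * q' j k) = (\<Sum>j\<in>J. p j i * q j k))"
  using assms(2,3)
proof (induction "sum s J" arbitrary: p q s rule: less_induct)
  case less
  note bound = less.prems(1) and lin = less.prems(2)
  show ?case
  proof (cases "\<forall>j\<in>J. \<forall>k\<in>C. \<forall>w. wcoeff (q j k) w \<noteq> 0 \<and> 0 < s j \<longrightarrow> s j + length w + \<beta> k \<le> 2")
    case True
    with bound show ?thesis by blast
  next
    case False
    then obtain j0 k w0 where k: "k \<in> C" and j0: "j0 \<in> J" "0 < s j0" "wcoeff (q j0 k) w0 \<noteq> 0"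
      and big: "2 < s j0 + length w0 + \<beta> k" by (auto simp: not_le)
    define S where "S = (SIGMA j:{j\<in>J. 0 < s j}. Poly_Mapping.keys (q j k))"
    have S: "(j, w) \<in> S \<longleftrightarrow> j \<in> J \<and> 0 < s j \<and> wcoeff (q j k) w \<noteq> 0" for j w
      by (auto simp: S_def in_keys_iff)
    have fin: "finite S" unfolding S_def using \<open>finite J\<close> by auto
    \<comment> \<open>The pair \<open>(i, w)\<close> to be eliminated has the largest total degree \<open>s i + length w\<close>
      and, among those, the largest \<open>s i\<close>.\<close>
    define D where "D = Max ((\<lambda>(j, w). s j + length w) ` S)"
    have D: "s j + length w \<le> D" if "(j, w) \<in> S" for j w
      unfolding D_def using fin that by (intro Max_ge) force+
    have "(j0, w0) \<in> S" using j0 S by blast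
    then have "D \<in> (\<lambda>(j, w). s j + length w) ` S"
      unfolding D_def using fin by (intro Max_in) auto
    then obtain j1 w1 where 1: "(j1, w1) \<in> S" "s j1 + length w1 = D" by auto
    define S' where "S' = {(j, w) \<in> S. s j + length w = D}"
    have "S' \<subseteq> S" by (auto simp: S'_def)
    then have "finite S'" using fin by (rule finite_subset)
    have "(j1, w1) \<in> S'" using 1 by (simp add: S'_def)
    define m where "m = Max ((\<lambda>(j, w). s j) ` S')"
    have m: "s j \<le> m" if "(j, w) \<in> S'" for j w
      unfolding m_def using \<open>finite S'\<close> that by (intro Max_ge) force+
    have "m \<in> (\<lambda>(j, w). s j) ` S'"
      unfolding m_def using \<open>finite S'\<close> \<open>(j1, w1) \<in> S'\<close> by (intro Max_in) auto
    then obtain i w where iw: "(i, w) \<in> S'" "s i = m" by auto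
    have i: "i \<in> J" "0 < s i" "wcoeff (q i k) w \<noteq> 0" and iD: "s i + length w = D"
      using iw(1) S by (auto simp: S'_def)
    have big': "2 < s i + length w + \<beta> k"
      using D[OF \<open>(j0, w0) \<in> S\<close>] big iD by linarith
    have maxD: "s j + length y \<le> s i + length w" if "j \<in> J" "0 < s j" "wcoeff (q j k) y \<noteq> 0" for j y
      using D S that iD by blast
    have tie: "s j \<le> s i"
      if "j \<in> J" "0 < s j" "wcoeff (q j k) y \<noteq> 0" "s j + length y = s i + length w" for j y
      using m[of j y] S that iD iw(2) by (auto simp: S'_def)
    define c where "c = wcoeff (q i k) w"
    have c: "c \<noteq> 0" using i c_def by simp
    define b where "b j = strip_suffix w (q j k) * const (1 / c)" for j
    \<comment> \<open>Maximality of the pair \<open>(i, w)\<close> leaves no word of \<open>q i k\<close> that ends in \<open>w\<close> other than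
      \<open>w\<close> itself; so the new column \<open>i\<close> of the left factor is the old one plus a combination of the others.\<close>
    have b_i: "b i = 1"
    proof -
      have "strip_suffix w (q i k) = const c"
      proof (rule poly_mapping_eqI)
        fix y
        have "wcoeff (q i k) (y @ w) = 0" if "y \<noteq> []"
          using maxD[of i "y @ w"] i that by (cases "wcoeff (q i k) (y @ w) = 0") auto
        then show "wcoeff (strip_suffix w (q i k)) y = wcoeff (const c) y"
          by (auto simp: lookup_strip_suffix c_def const_def lookup_single when_def)
      qed
      then show ?thesis using c by (simp add: b_def flip: const_mult const_1)
    qed
    define p' where "p' j r = (if j = i then \<Sum>j'\<in>J. p j' r * b j' else p j r)" for j r
    define q' where "q' j l = (if j = i then q i l else q j l - b j * q i l)" for j l
    define s' where "s' = s(i := s i - 1)"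
    \<comment> \<open>An elementary column operation on the left factor, undone by the inverse row operation
      on the right factor.\<close>
    have same: "(\<Sum>j\<in>J. p' j r * q' j l) = (\<Sum>j\<in>J. p j r * q j l)" for r l
    proof -
      have "(\<Sum>j\<in>J. p' j r * q' j l) = p' i r * q' i l + (\<Sum>j\<in>J - {i}. p' j r * q' j l)"
        using \<open>finite J\<close> i by (simp add: sum.remove)
      also have "(\<Sum>j\<in>J - {i}. p' j r * q' j l)
          = (\<Sum>j\<in>J - {i}. p j r * q j l) - (\<Sum>j\<in>J - {i}. p j r * b j) * q i l"
        by (simp add: p'_def q'_def right_diff_distrib sum_subtractf sum_distrib_right mult.assoc)
      also have "p' i r * q' i l = p i r * q i l + (\<Sum>j\<in>J - {i}. p j r * b j) * q i l"
        using \<open>finite J\<close> i by (simp add: p'_def q'_def sum.remove b_i distrib_right)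
      finally show ?thesis using \<open>finite J\<close> i by (simp add: sum.remove)
    qed
    have low: "wcoeff (p' i r) u = 0" if r: "r \<in> I" and u: "s i - 1 \<le> length u + \<alpha> r" for r u
    proof -
      have strip: "wcoeff (p j r * strip_suffix w (q j k)) u = wcoeff (p j r * q j k) (u @ w)"
        if j: "j \<in> J" for j
      proof -
        let ?t = "\<lambda>t. wcoeff (p j r) (take t (u @ w)) * wcoeff (q j k) (drop t (u @ w))"
        \<comment> \<open>A split of \<open>u @ w\<close> inside \<open>w\<close> would pair a word of length greater than \<open>length u\<close> of \<open>p j r\<close>
          with a proper suffix of \<open>w\<close>: such a pair also has maximal total degree, and \<open>s j > s i\<close> contradicts the choice of \<open>i\<close>.\<close>
        have "?t t = 0" if t: "length u < t" "t \<le> length (u @ w)" for t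
        proof (rule ccontr)
          assume "?t t \<noteq> 0"
          then have nz: "wcoeff (p j r) (take t (u @ w)) \<noteq> 0" "wcoeff (q j k) (drop t (u @ w)) \<noteq> 0"
            by auto
          have x: "t + \<alpha> r < s j" using bound[rule_format, OF j r nz(1)] t by simp
          have y: "s j + (length u + length w - t) \<le> s i + length w"
            using maxD[OF j _ nz(2)] x by simp
          have "s j + length (drop t (u @ w)) = s i + length w"
            using x y u t by simp
          from tie[OF j _ nz(2) this] x t u show False by simp
        qed
        then have "sum ?t {..length (u @ w)} = sum ?t {..length u}"
          by (intro sum.mono_neutral_right) (auto simp: not_le)
        then show ?thesis
          by (simp add: lookup_times_splits lookup_strip_suffix)
      qed
      have "wcoeff (p' i r) u = (\<Sum>j\<in>J. wcoeff (p j r * strip_suffix w (q j k)) u) * (1 / c)"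
        by (simp add: p'_def b_def lookup_sum lookup_times_const sum_divide_distrib
            flip: mult.assoc)
      also have "(\<Sum>j\<in>J. wcoeff (p j r * strip_suffix w (q j k)) u)
          = wcoeff (\<Sum>j\<in>J. p j r * q j k) (u @ w)"
        by (simp add: strip lookup_sum)
      also have "\<dots> = 0"
        using lin[rule_format, OF r k, of "u @ w"] u big' i(2) by force
      finally show ?thesis by simp
    qed
    have bound': "\<forall>j\<in>J. \<forall>r\<in>I. \<forall>u. wcoeff (p' j r) u \<noteq> 0 \<longrightarrow> length u + \<alpha> r < s' j"
    proof (intro ballI allI impI)
      fix j r u assume "j \<in> J" "r \<in> I" "wcoeff (p' j r) u \<noteq> 0"
      then show "length u + \<alpha> r < s' j"
        using bound low[of r u]
        by (cases "j = i"; cases "s i - 1 \<le> length u + \<alpha> r") (auto simp: s'_def p'_def)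
    qed
    have "sum s' J < sum s J"
      using \<open>finite J\<close> i by (intro sum_strict_mono_ex1) (auto simp: s'_def)
    from less.hyps[OF this bound', of q'] lin
    show ?thesis unfolding same by simp
  qed
qed

section \<open>Coordinate vectors\<close>

text \<open>Vectors of length \<open>n\<close> are functions on the natural numbers that vanish from \<open>n\<close> on. In this form vectors of
different lengths live in one vector space, and its notion of dimension serves for all of them.\<close>

interpretation fun_space: vector_space "\<lambda>(c::'k::field) (x::nat \<Rightarrow> 'k) i. c * x i"
  by unfold_locales (auto simp: fun_eq_iff algebra_simps)

definition coord_space :: "nat \<Rightarrow> (nat \<Rightarrow> 'k::field) set" where
  "coord_space n = {x. \<forall>i\<ge>n. x i = 0}"

definition unit_fun :: "nat \<Rightarrow> nat \<Rightarrow> 'k::field" where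
  "unit_fun i = (\<lambda>j. if j = i then 1 else 0)"

lemma subspace_coord_space: "fun_space.subspace (coord_space n)"
  by (auto simp: fun_space.subspace_def coord_space_def)

lemma sum_fun_apply: "(\<Sum>a\<in>A. f a) i = (\<Sum>a\<in>A. f a i)" for f :: "'a \<Rightarrow> 'b \<Rightarrow> 'c::comm_monoid_add"
  by (induction A rule: infinite_finite_induct) auto

lemma coord_space_span:
  "(coord_space n :: (nat \<Rightarrow> 'k::field) set) \<subseteq> fun_space.span (unit_fun ` {..<n})"
proof
  fix x :: "nat \<Rightarrow> 'k" assume x: "x \<in> coord_space n"
  have "x = (\<Sum>i<n. (\<lambda>j. x i * unit_fun i j))"
  proof
    fix j
    have "(\<Sum>i<n. (\<lambda>j. x i * unit_fun i j)) j = (\<Sum>i<n. if i = j then x j else 0)"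
      unfolding sum_fun_apply by (rule sum.cong) (auto simp: unit_fun_def)
    then show "x j = (\<Sum>i<n. (\<lambda>j. x i * unit_fun i j)) j"
      using x by (simp add: coord_space_def not_less)
  qed
  also have "\<dots> \<in> fun_space.span (unit_fun ` {..<n})"
    by (intro fun_space.span_sum fun_space.span_scale fun_space.span_base) auto
  finally show "x \<in> fun_space.span (unit_fun ` {..<n})" .
qed

lemma card_independent_le:
  assumes "fun_space.independent B" "B \<subseteq> coord_space n"
  shows "finite B" "card B \<le> n"
proof -
  have "finite B \<and> card B \<le> card (unit_fun ` {..<n} :: (nat \<Rightarrow> 'a) set)"
    using assms coord_space_span by (intro fun_space.independent_span_bound) auto
  moreover have "card (unit_fun ` {..<n} :: (nat \<Rightarrow> 'a) set) \<le> n"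
    using card_image_le[of "{..<n}"] by auto
  ultimately show "finite B" "card B \<le> n" by auto
qed

lemma dim_le_of_coord_space:
  assumes "V \<subseteq> coord_space n"
  shows "fun_space.dim V \<le> n"
  by (metis assms card_independent_le(2) fun_space.basis_exists subset_trans)

lemma dim_coord_space: "fun_space.dim (coord_space n :: (nat \<Rightarrow> 'k::field) set) = n"
proof -
  have inj: "inj_on (unit_fun :: nat \<Rightarrow> nat \<Rightarrow> 'k) {..<n}"
    by (auto simp: inj_on_def unit_fun_def fun_eq_iff split: if_splits)
  have ind: "fun_space.independent (unit_fun ` {..<n} :: (nat \<Rightarrow> 'k) set)"
  proof (rule fun_space.independent_if_scalars_zero)
    fix f :: "(nat \<Rightarrow> 'k) \<Rightarrow> 'k" and x :: "nat \<Rightarrow> 'k"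
    assume 0: "(\<Sum>x\<in>unit_fun ` {..<n}. (\<lambda>i. f x * x i)) = 0" and "x \<in> unit_fun ` {..<n}"
    then obtain i where i: "i < n" "x = unit_fun i" by auto
    have "0 = (\<Sum>j<n. (\<lambda>i. f (unit_fun j) * unit_fun j i)) i"
      using 0 by (simp add: sum.reindex[OF inj])
    also have "\<dots> = (\<Sum>j<n. if j = i then f (unit_fun i) else 0)"
      unfolding sum_fun_apply by (rule sum.cong) (auto simp: unit_fun_def)
    finally show "f x = 0" using i by simp
  qed auto
  have "unit_fun ` {..<n} \<subseteq> (coord_space n :: (nat \<Rightarrow> 'k) set)"
    by (auto simp: unit_fun_def coord_space_def)
  from fun_space.basis_card_eq_dim[OF this coord_space_span ind]
  have "fun_space.dim (coord_space n :: (nat \<Rightarrow> 'k) set) = card (unit_fun ` {..<n} :: (nat \<Rightarrow> 'k) set)"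
    by simp
  then show ?thesis by (simp add: card_image[OF inj])
qed

lemma eq_coord_space:
  assumes V: "fun_space.subspace V" "V \<subseteq> coord_space n" and dim: "n \<le> fun_space.dim V"
  shows "V = coord_space n"
proof (rule ccontr)
  assume "V \<noteq> coord_space n"
  then obtain x where x: "x \<in> coord_space n" "x \<notin> V" using V by auto
  obtain B where B: "B \<subseteq> V" "fun_space.independent B" "V \<subseteq> fun_space.span B" "card B = fun_space.dim V"
    by (rule fun_space.basis_exists)
  have "fun_space.span B \<subseteq> V" using B V fun_space.span_minimal by blast
  then have "x \<notin> fun_space.span B" using x by auto
  then have "fun_space.independent (insert x B)" using B by (simp add: fun_space.independent_insertI)
  moreover have "insert x B \<subseteq> coord_space n" using x B V by auto
  ultimately have "card (insert x B) \<le> n" by (rule card_independent_le)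
  moreover have "x \<notin> B" "finite B"
    using x B card_independent_le(1)[of B n] V by auto
  ultimately show False using B dim by simp
qed

lemma rank_nullity_le:
  fixes f :: "(nat \<Rightarrow> 'k::field) \<Rightarrow> nat \<Rightarrow> 'k"
  assumes add: "\<And>x y. f (x + y) = f x + f y"
    and scale: "\<And>c x. f (\<lambda>i. c * x i) = (\<lambda>i. c * f x i)"
    and V: "fun_space.subspace V" "V \<subseteq> coord_space n" and fV: "f ` V \<subseteq> coord_space m"
  shows "fun_space.dim V \<le> fun_space.dim {x \<in> V. f x = 0} + fun_space.dim (f ` V)"
proof -
  obtain B where B: "B \<subseteq> {x \<in> V. f x = 0}" "fun_space.independent B"
    "{x \<in> V. f x = 0} \<subseteq> fun_space.span B" "card B = fun_space.dim {x \<in> V. f x = 0}"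
    by (rule fun_space.basis_exists)
  obtain C where C: "C \<subseteq> f ` V" "fun_space.independent C"
    "f ` V \<subseteq> fun_space.span C" "card C = fun_space.dim (f ` V)"
    by (rule fun_space.basis_exists)
  have "B \<subseteq> coord_space n" "C \<subseteq> coord_space m" using B C V fV by auto
  then have fin: "finite B" "finite C"
    using card_independent_le(1)[OF B(2)] card_independent_le(1)[OF C(2)] by auto
  have "\<forall>c\<in>C. \<exists>x. x \<in> V \<and> f x = c" using C(1) by blast
  then obtain g where g: "\<And>c. c \<in> C \<Longrightarrow> g c \<in> V \<and> f (g c) = c"
    using bchoice[of C "\<lambda>c x. x \<in> V \<and> f x = c"] by blast
  have f0: "f 0 = 0" using add[of 0 0] by simp
  have lin: "f (\<Sum>c\<in>S. (\<lambda>i. u c * h c i)) = (\<Sum>c\<in>S. (\<lambda>i. u c * f (h c) i))" for u h and S :: "(nat \<Rightarrow> 'k) set"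
  proof (induction S rule: infinite_finite_induct)
    case (insert c S)
    have "f (\<Sum>c\<in>insert c S. (\<lambda>i. u c * h c i)) = f ((\<lambda>i. u c * h c i) + (\<Sum>c\<in>S. (\<lambda>i. u c * h c i)))"
      using insert.hyps by simp
    also have "\<dots> = (\<lambda>i. u c * f (h c) i) + (\<Sum>c\<in>S. (\<lambda>i. u c * f (h c) i))"
      unfolding add scale insert.IH ..
    also have "\<dots> = (\<Sum>c\<in>insert c S. (\<lambda>i. u c * f (h c) i))"
      using insert.hyps by simp
    finally show ?case .
  qed (simp_all add: f0[unfolded zero_fun_def])
  have "V \<subseteq> fun_space.span (B \<union> g ` C)"
  proof
    fix x assume x: "x \<in> V"
    then have "f x \<in> fun_space.span C" using C by auto
    then obtain u where u: "f x = (\<Sum>c\<in>C. (\<lambda>i. u c * c i))"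
      by (auto simp: fun_space.span_finite[OF fin(2)])
    define y where "y = (\<Sum>c\<in>C. (\<lambda>i. u c * g c i))"
    have "f y = f x" unfolding y_def lin u by (rule sum.cong) (auto simp: g)
    moreover have "f (x - y) = f x - f y"
      using add[of "x - y" y] by simp
    moreover have "y \<in> V" unfolding y_def
      by (intro fun_space.subspace_sum[OF V(1)] fun_space.subspace_scale[OF V(1)]) (auto simp: g)
    ultimately have "x - y \<in> {x \<in> V. f x = 0}"
      using x V by (simp add: fun_space.subspace_diff)
    then have "x - y \<in> fun_space.span (B \<union> g ` C)"
      using B(3) fun_space.span_mono[of B "B \<union> g ` C"] by blast
    moreover have "y \<in> fun_space.span (B \<union> g ` C)"
      unfolding y_def by (intro fun_space.span_sum fun_space.span_scale fun_space.span_base) auto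
    ultimately have "(x - y) + y \<in> fun_space.span (B \<union> g ` C)" by (rule fun_space.span_add)
    then show "x \<in> fun_space.span (B \<union> g ` C)" by simp
  qed
  then have "fun_space.dim V \<le> card (B \<union> g ` C)"
    using fin by (intro fun_space.dim_le_card) auto
  also have "\<dots> \<le> card B + card (g ` C)" by (rule card_Un_le)
  also have "card (g ` C) \<le> card C" using fin by (intro card_image_le)
  finally show ?thesis using B C by simp
qed

text \<open>Each linear condition lowers the dimension by at most one.\<close>

lemma dim_common_kernel:
  fixes \<phi> :: "'j \<Rightarrow> (nat \<Rightarrow> 'k::field) \<Rightarrow> 'k"
  assumes "finite J"
    and add: "\<And>j x y. \<phi> j (x + y) = \<phi> j x + \<phi> j y"
    and scale: "\<And>j c x. \<phi> j (\<lambda>i. c * x i) = c * \<phi> j x"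
  shows "fun_space.subspace {x \<in> coord_space n. \<forall>j\<in>J. \<phi> j x = 0} \<and>
    n \<le> fun_space.dim {x \<in> coord_space n. \<forall>j\<in>J. \<phi> j x = 0} + card J"
  using \<open>finite J\<close>
proof (induction J)
  case empty
  show ?case by (simp add: dim_coord_space subspace_coord_space)
next
  case (insert j J)
  let ?V = "{x \<in> coord_space n. \<forall>j\<in>J. \<phi> j x = 0}"
  define f where "f x = (\<lambda>i::nat. if i = 0 then \<phi> j x else 0)" for x
  have f1: "f ` ?V \<subseteq> coord_space 1" by (auto simp: f_def coord_space_def)
  have eq: "{x \<in> coord_space n. \<forall>j\<in>insert j J. \<phi> j x = 0} = {x \<in> ?V. f x = 0}"
    by (auto simp: f_def fun_eq_iff)
  have 0: "\<phi> j 0 = 0" for j using add[of j 0 0] by (metis add.right_neutral add_left_cancel)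
  have "fun_space.subspace {x \<in> ?V. f x = 0}"
    unfolding eq[symmetric] using subspace_coord_space[of n]
    by (auto simp: fun_space.subspace_def add scale 0)
  moreover have "fun_space.dim ?V \<le> fun_space.dim {x \<in> ?V. f x = 0} + fun_space.dim (f ` ?V)"
    using insert f1 by (intro rank_nullity_le[where n = n]) (auto simp: f_def add scale fun_eq_iff)
  moreover have "fun_space.dim (f ` ?V) \<le> 1" using f1 by (rule dim_le_of_coord_space)
  ultimately show ?case unfolding eq using insert by auto
qed

text \<open>A basis of \<open>V\<close>, extended to a basis of the whole space, supplies the columns of \<open>P\<close>. Such a base change turns
statements about subspaces into statements about blocks of matrices.\<close>

lemma adapted_basis_matrix:
  fixes V :: "(nat \<Rightarrow> 'k::field) set"
  assumes V: "V \<subseteq> coord_space n"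
  obtains P P' where "P \<in> carrier_mat n n" "P' \<in> carrier_mat n n" "P * P' = 1\<^sub>m n" "P' * P = 1\<^sub>m n"
    "\<And>j. j < fun_space.dim V \<Longrightarrow> (\<lambda>i. if i < n then P $$ (i, j) else 0) \<in> V"
proof -
  obtain B where B: "B \<subseteq> V" "fun_space.independent B" "V \<subseteq> fun_space.span B" "card B = fun_space.dim V"
    by (rule fun_space.basis_exists)
  obtain C where C: "B \<subseteq> C" "C \<subseteq> coord_space n" "fun_space.independent C"
      "coord_space n \<subseteq> fun_space.span C"
    using fun_space.maximal_independent_subset_extend[OF subset_trans[OF B(1) V] B(2)] by blast
  have finC: "finite C" using C(3,2) by (rule card_independent_le(1))
  have cardC: "card C = n" using fun_space.basis_card_eq_dim[OF C(2,4,3)] dim_coord_space by simp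
  obtain xs where xs: "set xs = B" "distinct xs"
    using finite_distinct_list[of B] finite_subset[OF C(1) finC] by blast
  obtain ys where ys: "set ys = C - B" "distinct ys"
    using finite_distinct_list[of "C - B"] finC by blast
  define zs where "zs = xs @ ys"
  have zs: "set zs = C" "distinct zs" using xs ys C(1) by (auto simp: zs_def)
  have len: "length zs = n" "length xs = fun_space.dim V"
    using cardC zs B(4) xs distinct_card[of zs] distinct_card[of xs] by simp_all
  have mem: "zs ! j \<in> coord_space n" if "j < n" for j
    using that len zs C(2) nth_mem[of j zs] by auto
  have "\<exists>u. unit_fun k = (\<Sum>c\<in>C. (\<lambda>i. u c * c i))" if "k < n" for k
  proof -
    have "(unit_fun k :: nat \<Rightarrow> 'k) \<in> fun_space.span C"
      using C(4) that by (auto simp: coord_space_def unit_fun_def)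
    then show ?thesis by (auto simp: fun_space.span_finite[OF finC])
  qed
  then have "\<forall>k\<in>{..<n}. \<exists>u. unit_fun k = (\<Sum>c\<in>C. (\<lambda>i. u c * c i))" by blast
  from bchoice[OF this] obtain u where
    u: "\<And>k. k < n \<Longrightarrow> unit_fun k = (\<Sum>c\<in>C. (\<lambda>i. u k c * c i))" by blast
  define P where "P = mat n n (\<lambda>(i, j). (zs ! j) i)"
  define P' where "P' = mat n n (\<lambda>(j, k). u k (zs ! j))"
  have car: "P \<in> carrier_mat n n" "P' \<in> carrier_mat n n" by (auto simp: P_def P'_def)
  have bij: "bij_betw ((!) zs) {..<n} C" using zs len by (simp add: bij_betw_nth)
  have PP': "P * P' = 1\<^sub>m n"
  proof (rule eq_matI)
    fix i k assume "i < dim_row (1\<^sub>m n)" "k < dim_col (1\<^sub>m n)"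
    then have ik: "i < n" "k < n" by auto
    have "(P * P') $$ (i, k) = (\<Sum>j<n. (zs ! j) i * u k (zs ! j))"
      using ik by (simp add: P_def P'_def scalar_prod_def atLeast0LessThan)
    also have "\<dots> = (\<Sum>c\<in>C. c i * u k c)"
      by (rule sum.reindex_bij_betw[OF bij])
    also have "\<dots> = unit_fun k i"
      unfolding u[OF ik(2)] sum_fun_apply by (simp add: mult.commute)
    finally show "(P * P') $$ (i, k) = 1\<^sub>m n $$ (i, k)" using ik by (simp add: unit_fun_def)
  qed (auto simp: P_def P'_def)
  moreover have "P' * P = 1\<^sub>m n" using car PP' by (rule mat_mult_left_right_inverse)
  moreover have "(\<lambda>i. if i < n then P $$ (i, j) else 0) \<in> V" if j: "j < fun_space.dim V" for j
  proof -
    have jn: "j < n" using j dim_le_of_coord_space[OF V] by simp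
    have "(\<lambda>i. if i < n then P $$ (i, j) else 0) = zs ! j"
      using mem[OF jn] jn by (auto simp: P_def coord_space_def fun_eq_iff)
    also have "\<dots> \<in> B" using j len xs nth_mem[of j xs] by (simp add: nth_append zs_def)
    finally show ?thesis using B by auto
  qed
  ultimately show thesis using car that by blast
qed

section \<open>Pencils\<close>

lemma wcoeff_const: "wcoeff (const c) w = (if w = [] then c else 0)"
  by (auto simp: const_def lookup_single when_def)

lemma wcoeff_letter: "wcoeff (letter x) w = (if w = [x] then 1 else 0)"
  by (auto simp: letter_def lookup_single when_def)

text \<open>In terms of degrees, pencils are visibly stable under multiplication by scalar matrices and under passing to
blocks.\<close>

lemma linear_pencil_iff:
  fixes A :: "('k::field, 'x::finite) free_algebra mat"
  shows "linear_pencil n A \<longleftrightarrow> A \<in> carrier_mat n n \<and>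
    (\<forall>i<n. \<forall>j<n. \<forall>w. wcoeff (A $$ (i, j)) w \<noteq> 0 \<longrightarrow> length w \<le> 1)"
    (is "_ \<longleftrightarrow> _ \<and> ?deg")
proof
  have sum: "wcoeff (\<Sum>x\<in>UNIV. const (c x) * letter x) w = (\<Sum>x\<in>UNIV. if w = [x] then c x else 0)"
    for c :: "'x \<Rightarrow> 'k" and w
    unfolding lookup_sum by (rule sum.cong) (auto simp: lookup_const_times wcoeff_letter)
  {
    assume A: "linear_pencil n A"
    have "length w \<le> 1" if ij: "i < n" "j < n" and w: "wcoeff (A $$ (i, j)) w \<noteq> 0" for i j w
    proof (rule ccontr)
      assume long: "\<not> length w \<le> 1"
      obtain A\<^sub>0 A\<^sub>1 where "A $$ (i, j) = const (A\<^sub>0 $$ (i, j)) + (\<Sum>x \<in> UNIV. const (A\<^sub>1 x $$ (i, j)) * letter x)"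
        using A ij unfolding linear_pencil_def by blast
      then have "wcoeff (A $$ (i, j)) w = 0"
        using long by (auto simp: lookup_add sum wcoeff_const intro!: sum.neutral)
      with w show False by simp
    qed
    then show "A \<in> carrier_mat n n \<and> ?deg" using A by (auto simp: linear_pencil_def)
  next
    assume A: "A \<in> carrier_mat n n \<and> ?deg"
    define A\<^sub>0 where "A\<^sub>0 = mat n n (\<lambda>ij. wcoeff (A $$ ij) [])"
    define A\<^sub>1 where "A\<^sub>1 x = mat n n (\<lambda>ij. wcoeff (A $$ ij) [x])" for x
    have "A $$ (i, j) = const (A\<^sub>0 $$ (i, j)) + (\<Sum>x \<in> UNIV. const (A\<^sub>1 x $$ (i, j)) * letter x)"
      if ij: "i < n" "j < n" for i j
    proof (rule poly_mapping_eqI)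
      fix w :: "'x list"
      consider "w = []" | x where "w = [x]" | "1 < length w"
        by (cases w rule: remdups_adj.cases) auto
      then show "wcoeff (A $$ (i, j)) w =
          wcoeff (const (A\<^sub>0 $$ (i, j)) + (\<Sum>x \<in> UNIV. const (A\<^sub>1 x $$ (i, j)) * letter x)) w"
      proof cases
        case 3
        then have "wcoeff (A $$ (i, j)) w = 0" using A ij not_le by blast
        moreover have "(\<Sum>x\<in>UNIV. if w = [x] then A\<^sub>1 x $$ (i, j) else 0) = 0"
          using 3 by (intro sum.neutral) auto
        ultimately show ?thesis using 3 by (auto simp: lookup_add sum wcoeff_const)
      qed (use ij in \<open>simp_all add: lookup_add sum wcoeff_const A\<^sub>0_def A\<^sub>1_def\<close>)
    qed
    then show "linear_pencil n A"
      unfolding linear_pencil_def using A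
      by (intro conjI bexI[of _ A\<^sub>0] exI[of _ A\<^sub>1]) (auto simp: A\<^sub>0_def A\<^sub>1_def)
  }
qed

text \<open>The equation \<open>l A r = 0\<close> for all \<open>l \<in> L\<close> and \<open>r \<in> R\<close>: after a base change adapted to \<open>L\<close> and \<open>R\<close> it says that
\<open>A\<close> has a block of zeros.\<close>

definition annihilates ::
  "nat \<Rightarrow> ('k::field, 'x) free_algebra mat \<Rightarrow> (nat \<Rightarrow> 'k) set \<Rightarrow> (nat \<Rightarrow> 'k) set \<Rightarrow> bool" where
  "annihilates n A L R \<longleftrightarrow>
    (\<forall>l\<in>L. \<forall>r\<in>R. (\<Sum>i<n. \<Sum>j<n. const (l i) * A $$ (i, j) * const (r j)) = 0)"

text \<open>A factorization of the bordered matrix can be reduced so that every column of the left factor is constant or is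
matched by a constant row of the right factor. The vectors orthogonal to the constant columns form \<open>L\<close>, those
orthogonal to the constant rows form \<open>R\<close>, and every summand of the product is killed by one or the other.

The border consists of constants, so it may be given the extra degree one. This is the reason for
the weights: a column that is constant in the weighted sense vanishes on the border, hence the border
coordinate of vectors in \<open>L\<close> and \<open>R\<close> is free, and the three equations for \<open>A\<close>, \<open>v\<close> and \<open>u\<close> hold separately. With weights
zero one would only obtain them up to constants that are shifted between \<open>A\<close>, \<open>u\<close> and \<open>v\<close>.\<close>

lemma bordered_factorization:
  fixes A :: "('k::field, 'x::finite) free_algebra mat"
  assumes A: "linear_pencil n A" and u: "u \<in> carrier_mat 1 n" and v: "v \<in> carrier_mat n 1"
    and T: "T \<in> carrier_mat (n + 1) m" and U: "U \<in> carrier_mat m (n + 1)"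
    and TU: "four_block_mat A (const_mat v) (const_mat u) (0\<^sub>m 1 1) = T * U"
  shows "\<exists>L R. fun_space.subspace L \<and> L \<subseteq> coord_space n \<and> fun_space.subspace R \<and> R \<subseteq> coord_space n \<and>
    2 * n \<le> fun_space.dim L + fun_space.dim R + m \<and> annihilates n A L R \<and>
    (\<forall>l\<in>L. (\<Sum>i<n. l i * v $$ (i, 0)) = 0) \<and> (\<forall>r\<in>R. (\<Sum>j<n. u $$ (0, j) * r j) = 0)"
proof -
  define M where "M = four_block_mat A (const_mat v) (const_mat u) (0\<^sub>m 1 1)"
  define w :: "nat \<Rightarrow> nat" where "w i = (if i = n then 1 else 0)" for i
  have A_carrier: "A \<in> carrier_mat n n" using A by (simp add: linear_pencil_def)
  have M: "M $$ (i, k) = (\<Sum>j<m. T $$ (i, j) * U $$ (j, k))" if "i < Suc n" "k < Suc n" for i k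
    using T U that unfolding M_def TU by (simp add: scalar_prod_def atLeast0LessThan)
  have M_deg: "length y + w i + w k \<le> 1" if "i < Suc n" "k < Suc n" "wcoeff (M $$ (i, k)) y \<noteq> 0" for i k y
    using that A[unfolded linear_pencil_iff] u v A_carrier
    by (auto simp: M_def w_def wcoeff_const less_Suc_eq split: if_splits)
  \<comment> \<open>Any bound on the weighted degrees will do to start the reduction.\<close>
  define s where "s j = Suc (\<Sum>i<Suc n. \<Sum>y\<in>Poly_Mapping.keys (T $$ (i, j)). length y + w i)" for j
  have s: "length y + w i < s j" if "i < Suc n" "wcoeff (T $$ (i, j)) y \<noteq> 0" for i j y
  proof -
    have "length y + w i \<le> (\<Sum>y\<in>Poly_Mapping.keys (T $$ (i, j)). length y + w i)"
      using that by (intro member_le_sum[of y _ "\<lambda>y. length y + w i"]) (auto simp: in_keys_iff)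
    also have "\<dots> \<le> (\<Sum>i<Suc n. \<Sum>y\<in>Poly_Mapping.keys (T $$ (i, j)). length y + w i)"
      using that by (intro member_le_sum[of i _ "\<lambda>i. \<Sum>y\<in>Poly_Mapping.keys (T $$ (i, j)). length y + w i"]) auto
    finally show ?thesis by (simp add: s_def)
  qed
  have M_deg': "\<forall>i\<in>{..<Suc n}. \<forall>k\<in>{..<Suc n}. \<forall>y.
      wcoeff (\<Sum>j<m. T $$ (i, j) * U $$ (j, k)) y \<noteq> 0 \<longrightarrow> length y + w i + w k \<le> 1"
  proof (intro ballI allI impI)
    fix i k y
    assume ik: "i \<in> {..<Suc n}" "k \<in> {..<Suc n}"
      and "wcoeff (\<Sum>j<m. T $$ (i, j) * U $$ (j, k)) y \<noteq> 0"
    then show "length y + w i + w k \<le> 1" using M_deg[of i k y] M[of i k] by simp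
  qed
  have s': "\<forall>j\<in>{..<m}. \<forall>i\<in>{..<Suc n}. \<forall>y. wcoeff (T $$ (i, j)) y \<noteq> 0 \<longrightarrow> length y + w i < s j"
    using s by blast
  from factorization_degree_reduction[where q = "\<lambda>j k. U $$ (j, k)", OF finite_lessThan s' M_deg']
  obtain p q s' where
    p': "\<forall>j\<in>{..<m}. \<forall>i\<in>{..<Suc n}. \<forall>y. wcoeff (p j i) y \<noteq> 0 \<longrightarrow> length y + w i < s' j" and
    q': "\<forall>j\<in>{..<m}. \<forall>k\<in>{..<Suc n}. \<forall>y. wcoeff (q j k) y \<noteq> 0 \<and> 0 < s' j \<longrightarrow> s' j + length y + w k \<le> 2" and
    pq': "\<forall>i\<in>{..<Suc n}. \<forall>k\<in>{..<Suc n}. (\<Sum>j<m. p j i * q j k) = (\<Sum>j<m. T $$ (i, j) * U $$ (j, k))"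
    by blast
  have p: "length y + w i < s' j" if "j < m" "i < Suc n" "wcoeff (p j i) y \<noteq> 0" for j i y
    using p' that by blast
  have q: "s' j + length y + w k \<le> 2" if "j < m" "k < Suc n" "wcoeff (q j k) y \<noteq> 0" "0 < s' j" for j k y
    using q' that by blast
  have pq: "(\<Sum>j<m. p j i * q j k) = M $$ (i, k)" if "i < Suc n" "k < Suc n" for i k
    using pq' that by (simp add: M)
  define J0 where "J0 = {j. j < m \<and> s' j \<le> 1}"
  define J1 where "J1 = {j. j < m \<and> 2 \<le> s' j}"
  have fin: "finite J0" "finite J1" and card: "card J0 + card J1 = m"
  proof -
    show "finite J0" "finite J1" by (auto simp: J0_def J1_def)
    then have "card J0 + card J1 = card (J0 \<union> J1)"
      by (intro card_Un_disjoint[symmetric]) (auto simp: J0_def J1_def)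
    also have "J0 \<union> J1 = {..<m}" by (auto simp: J0_def J1_def)
    finally show "card J0 + card J1 = m" by simp
  qed
  define L where "L = {l \<in> coord_space n. \<forall>j\<in>J0. (\<Sum>i<n. l i * wcoeff (p j i) []) = 0}"
  define R where "R = {r \<in> coord_space n. \<forall>j\<in>J1. (\<Sum>k<n. wcoeff (q j k) [] * r k) = 0}"
  have L: "fun_space.subspace L \<and> n \<le> fun_space.dim L + card J0"
    unfolding L_def by (rule dim_common_kernel[OF fin(1)])
      (simp_all add: algebra_simps sum.distrib sum_distrib_left)
  have R: "fun_space.subspace R \<and> n \<le> fun_space.dim R + card J1"
    unfolding R_def by (rule dim_common_kernel[OF fin(2)])
      (simp_all add: algebra_simps sum.distrib sum_distrib_left)
  have p_deg: "length y + w i = 0" if "j \<in> J0" "i < Suc n" "wcoeff (p j i) y \<noteq> 0" for i j y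
  proof -
    have "j < m" "s' j \<le> 1" using that(1) by (simp_all add: J0_def)
    with p[of j i y] that show ?thesis by linarith
  qed
  have p_border: "p j n = 0" if "j \<in> J0" for j
  proof (rule poly_mapping_eqI)
    show "wcoeff (p j n) y = wcoeff 0 y" for y
      using p_deg[OF that, of n y] by (cases "wcoeff (p j n) y = 0") (auto simp: w_def)
  qed
  have p_const: "p j i = const (wcoeff (p j i) [])" if "j \<in> J0" "i < n" for i j
  proof (rule poly_mapping_eqI)
    show "wcoeff (p j i) y = wcoeff (const (wcoeff (p j i) [])) y" for y
      using p_deg[OF that(1), of i y] that(2)
      by (cases "wcoeff (p j i) y = 0") (auto simp: wcoeff_const)
  qed
  have q_deg: "length y + w k = 0" if "j \<in> J1" "k < Suc n" "wcoeff (q j k) y \<noteq> 0" for k j y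
  proof -
    have "j < m" "2 \<le> s' j" using that(1) by (simp_all add: J1_def)
    with q[of j k y] that show ?thesis by linarith
  qed
  have q_border: "q j n = 0" if "j \<in> J1" for j
  proof (rule poly_mapping_eqI)
    show "wcoeff (q j n) y = wcoeff 0 y" for y
      using q_deg[OF that, of n y] by (cases "wcoeff (q j n) y = 0") (auto simp: w_def)
  qed
  have q_const: "q j k = const (wcoeff (q j k) [])" if "j \<in> J1" "k < n" for k j
  proof (rule poly_mapping_eqI)
    show "wcoeff (q j k) y = wcoeff (const (wcoeff (q j k) [])) y" for y
      using q_deg[OF that(1), of k y] that(2)
      by (cases "wcoeff (q j k) y = 0") (auto simp: wcoeff_const)
  qed
  have vanish: "(\<Sum>i<Suc n. \<Sum>k<Suc n. const (l i) * M $$ (i, k) * const (r k)) = 0"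
    if l: "\<forall>j\<in>J0. (\<Sum>i<n. l i * wcoeff (p j i) []) = 0"
      and r: "\<forall>j\<in>J1. (\<Sum>k<n. wcoeff (q j k) [] * r k) = 0" for l r
  proof -
    have const_sum: "const (sum f X) = (\<Sum>x\<in>X. const (f x))" for f :: "nat \<Rightarrow> 'k" and X
      by (induction X rule: infinite_finite_induct) (auto simp: const_0 const_add)
    have zero: "(\<Sum>i<Suc n. const (l i) * p j i) * (\<Sum>k<Suc n. q j k * const (r k)) = 0" if "j < m" for j
    proof (cases "j \<in> J0")
      case True
      have "(\<Sum>i<Suc n. const (l i) * p j i) = (\<Sum>i<n. const (l i * wcoeff (p j i) []))"
        using p_border[OF True] p_const[OF True] by (simp add: const_mult)
      then show ?thesis using l True by (simp add: const_0 flip: const_sum)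
    next
      case False
      then have J1: "j \<in> J1" using that by (auto simp: J0_def J1_def)
      have "(\<Sum>k<Suc n. q j k * const (r k)) = (\<Sum>k<n. const (wcoeff (q j k) [] * r k))"
        using q_border[OF J1] q_const[OF J1] by (simp add: const_mult)
      then show ?thesis using r J1 by (simp add: const_0 flip: const_sum)
    qed
    have "(\<Sum>i<Suc n. \<Sum>k<Suc n. const (l i) * M $$ (i, k) * const (r k))
        = (\<Sum>i<Suc n. \<Sum>k<Suc n. \<Sum>j<m. const (l i) * p j i * (q j k * const (r k)))"
      by (intro sum.cong refl)
        (simp add: pq[symmetric] sum_distrib_left sum_distrib_right mult.assoc del: sum.lessThan_Suc)
    also have "\<dots> = (\<Sum>i<Suc n. \<Sum>j<m. \<Sum>k<Suc n. const (l i) * p j i * (q j k * const (r k)))"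
      by (intro sum.cong refl sum.swap)
    also have "\<dots> = (\<Sum>j<m. \<Sum>i<Suc n. \<Sum>k<Suc n. const (l i) * p j i * (q j k * const (r k)))"
      by (rule sum.swap)
    also have "\<dots> = (\<Sum>j<m. (\<Sum>i<Suc n. const (l i) * p j i) * (\<Sum>k<Suc n. q j k * const (r k)))"
      by (simp add: sum_product del: sum.lessThan_Suc)
    also have "\<dots> = 0" using zero by (intro sum.neutral) auto
    finally show ?thesis .
  qed
  have "annihilates n A L R"
    unfolding annihilates_def
  proof (intro ballI)
    fix l r assume lr: "l \<in> L" "r \<in> R"
    then have 0: "l n = 0" "r n = 0" by (auto simp: L_def R_def coord_space_def)
    have "(\<Sum>i<n. \<Sum>j<n. const (l i) * A $$ (i, j) * const (r j)) =
        (\<Sum>i<Suc n. \<Sum>k<Suc n. const (l i) * M $$ (i, k) * const (r k))"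
      using A_carrier u v by (simp add: 0 const_0 M_def)
    then show "(\<Sum>i<n. \<Sum>j<n. const (l i) * A $$ (i, j) * const (r j)) = 0"
      using vanish[of l r] lr by (simp add: L_def R_def)
  qed
  moreover have "(\<Sum>i<n. l i * v $$ (i, 0)) = 0" if l: "l \<in> L" for l
  proof -
    have 0: "l n = 0" using l by (auto simp: L_def coord_space_def)
    have "(\<Sum>i<n. const (l i * v $$ (i, 0))) =
        (\<Sum>i<Suc n. \<Sum>k<Suc n. const (l i) * M $$ (i, k) * const (unit_fun n k))"
      using A_carrier u v by (simp add: 0 const_0 const_1 const_mult M_def unit_fun_def)
    also have "\<dots> = 0" using l by (intro vanish) (auto simp: L_def unit_fun_def)
    finally have "wcoeff (\<Sum>i<n. const (l i * v $$ (i, 0))) ([] :: 'x list) = 0" by simp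
    then show ?thesis by (simp add: lookup_sum wcoeff_const)
  qed
  moreover have "(\<Sum>j<n. u $$ (0, j) * r j) = 0" if r: "r \<in> R" for r
  proof -
    have 0: "r n = 0" using r by (auto simp: R_def coord_space_def)
    have "(\<Sum>k<n. const (u $$ (0, k) * r k)) =
        (\<Sum>i<Suc n. \<Sum>k<Suc n. const (unit_fun n i) * M $$ (i, k) * const (r k))"
      using A_carrier u v by (simp add: 0 const_0 const_1 const_mult M_def unit_fun_def)
    also have "\<dots> = 0" using r by (intro vanish) (auto simp: R_def unit_fun_def)
    finally have "wcoeff (\<Sum>k<n. const (u $$ (0, k) * r k)) ([] :: 'x list) = 0" by simp
    then show ?thesis by (simp add: lookup_sum wcoeff_const)
  qed
  ultimately show ?thesis
    using L R card by (intro exI[of _ L] exI[of _ R]) (auto simp: L_def R_def)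
qed

section \<open>Zero blocks and full matrices\<close>

lemma full_matD:
  assumes "full_mat A" "A \<in> carrier_mat n n" "A = T * U" "T \<in> carrier_mat n m" "U \<in> carrier_mat m n"
  shows "n \<le> m"
proof (rule ccontr)
  assume "\<not> n \<le> m"
  then have "\<exists>m<n. \<exists>T\<in>carrier_mat n m. \<exists>U\<in>carrier_mat m n. A = T * U"
    using assms(3-5) not_le by blast
  with assms(1,2) show False by (simp add: full_mat_def)
qed

lemma full_mat_equiv:
  fixes A :: "'r::semiring_1 mat"
  assumes A: "A \<in> carrier_mat n n" and full: "full_mat A"
    and P: "P \<in> carrier_mat n n" "P' \<in> carrier_mat n n" "P' * P = 1\<^sub>m n"
    and Q: "Q \<in> carrier_mat n n" "Q' \<in> carrier_mat n n" "Q * Q' = 1\<^sub>m n"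
  shows "full_mat (P * A * Q)"
  unfolding full_mat_def
proof (intro conjI notI)
  show "square_mat (P * A * Q)" using A P Q by simp
  assume "\<exists>m<dim_row (P * A * Q). \<exists>T\<in>carrier_mat (dim_row (P * A * Q)) m.
    \<exists>U\<in>carrier_mat m (dim_row (P * A * Q)). P * A * Q = T * U"
  then obtain m T U where m: "m < n" and T: "T \<in> carrier_mat n m" and U: "U \<in> carrier_mat m n"
    and eq: "P * A * Q = T * U" using A P Q by auto
  have PA: "P * A \<in> carrier_mat n n" and UQ: "U * Q' \<in> carrier_mat m n" using A P Q U by auto
  have "A = (P' * P) * A * (Q * Q')" using A P Q by simp
  also have "\<dots> = P' * (P * A) * (Q * Q')" by (simp only: assoc_mult_mat[OF P(2,1) A])
  also have "\<dots> = P' * ((P * A) * (Q * Q'))"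
    by (rule assoc_mult_mat[OF P(2) PA mult_carrier_mat[OF Q(1,2)]])
  also have "(P * A) * (Q * Q') = (P * A * Q) * Q'"
    by (rule assoc_mult_mat[OF PA Q(1,2), symmetric])
  also have "\<dots> = T * (U * Q')" unfolding eq by (rule assoc_mult_mat[OF T U Q(2)])
  also have "P' * (T * (U * Q')) = (P' * T) * (U * Q')"
    by (rule assoc_mult_mat[OF P(2) T UQ, symmetric])
  finally have "A = (P' * T) * (U * Q')" .
  from full_matD[OF full A this mult_carrier_mat[OF P(2) T] UQ] m show False by simp
qed

text \<open>A zero block lets the matrix factor through one of the adjacent blocks \<open>B\<close>, \<open>C\<close>, taken as a whole, and the middle space of
a factorization of the other. With a trivial factorization these bounds limit the size of a zero block; with a short one they show
that a full matrix with a zero block of maximal size has full blocks \<open>B\<close> and \<open>C\<close>.\<close>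

lemma full_zero_block_lower:
  fixes B :: "'r::semiring_1 mat"
  assumes full: "full_mat (four_block_mat (0\<^sub>m k l) B (T * U) D)"
    and B: "B \<in> carrier_mat k b" and T: "T \<in> carrier_mat c m" and U: "U \<in> carrier_mat m l"
    and D: "D \<in> carrier_mat c b" and n: "k + c = n" "l + b = n"
  shows "n \<le> b + m"
proof (rule full_matD[OF full])
  show "four_block_mat (0\<^sub>m k l) B (T * U) D =
      four_block_mat B (0\<^sub>m k m) D T * four_block_mat (0\<^sub>m b l) (1\<^sub>m b) U (0\<^sub>m m b)"
    using B T U D by (subst mult_four_block_mat[of _ k b _ m _ c _ _ l _ b]) auto
qed (use B T U D n in auto)

lemma full_zero_block_upper:
  fixes C :: "'r::semiring_1 mat"
  assumes full: "full_mat (four_block_mat (0\<^sub>m k l) (T * U) C D)"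
    and C: "C \<in> carrier_mat c l" and T: "T \<in> carrier_mat k m" and U: "U \<in> carrier_mat m b"
    and D: "D \<in> carrier_mat c b" and n: "k + c = n" "l + b = n"
  shows "n \<le> m + c"
proof (rule full_matD[OF full])
  show "four_block_mat (0\<^sub>m k l) (T * U) C D =
      four_block_mat T (0\<^sub>m k c) (0\<^sub>m c m) (1\<^sub>m c) * four_block_mat (0\<^sub>m m l) U C D"
    using C T U D by (subst mult_four_block_mat[of _ k m _ c _ c _ _ l _ b]) auto
qed (use C T U D n in auto)

lemma const_mat_mult:
  fixes X Y :: "'k::field mat"
  assumes "X \<in> carrier_mat a b" "Y \<in> carrier_mat b c"
  shows "(const_mat (X * Y) :: ('k, 'x) free_algebra mat) = const_mat X * const_mat Y"
proof -
  interpret semiring_hom "const :: 'k \<Rightarrow> ('k, 'x) free_algebra"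
    by unfold_locales (auto simp: const_0 const_1 const_add const_mult)
  show ?thesis using assms by (rule mat_hom_mult)
qed

lemma const_mat_one: "const_mat (1\<^sub>m n) = 1\<^sub>m n"
  by (rule eq_matI) (auto simp: const_0 const_1)

lemma index_const_mat_mult3:
  assumes "X \<in> carrier_mat a n" "A \<in> carrier_mat n n" "Y \<in> carrier_mat n b" "i < a" "j < b"
  shows "(const_mat X * A * const_mat Y) $$ (i, j) =
    (\<Sum>c<n. \<Sum>d<n. const (X $$ (i, c)) * A $$ (c, d) * const (Y $$ (d, j)))"
proof -
  have "(const_mat X * A * const_mat Y) $$ (i, j) =
      (\<Sum>d<n. (\<Sum>c<n. const (X $$ (i, c)) * A $$ (c, d)) * const (Y $$ (d, j)))"
    using assms by (simp add: scalar_prod_def atLeast0LessThan del: assoc_mult_mat)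
  also have "\<dots> = (\<Sum>d<n. \<Sum>c<n. const (X $$ (i, c)) * A $$ (c, d) * const (Y $$ (d, j)))"
    by (simp add: sum_distrib_right)
  also have "\<dots> = (\<Sum>c<n. \<Sum>d<n. const (X $$ (i, c)) * A $$ (c, d) * const (Y $$ (d, j)))"
    by (rule sum.swap)
  finally show ?thesis .
qed

text \<open>The subspaces \<open>L\<close> and \<open>R\<close> become the first coordinates after a scalar base change, which produces the zero
block of size \<open>k \<times> l\<close>. The other blocks remain pencils, and for \<open>k + l = n\<close> the blocks \<open>B\<close> and \<open>C\<close> are square and full.\<close>

lemma annihilates_normal_form:
  fixes A :: "('k::field, 'x::finite) free_algebra mat"
  assumes A: "linear_pencil n A" and full: "full_mat A"
    and L: "L \<subseteq> coord_space n" and R: "R \<subseteq> coord_space n" and LR: "annihilates n A L R"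
  defines "k \<equiv> fun_space.dim L" and "l \<equiv> fun_space.dim R"
  obtains P P' Q Q' B C D where
    "P \<in> carrier_mat n n" "P' \<in> carrier_mat n n" "P' * P = 1\<^sub>m n"
    "Q \<in> carrier_mat n n" "Q' \<in> carrier_mat n n" "Q * Q' = 1\<^sub>m n"
    "\<And>i. i < k \<Longrightarrow> (\<lambda>a. if a < n then P $$ (i, a) else 0) \<in> L"
    "\<And>j. j < l \<Longrightarrow> (\<lambda>a. if a < n then Q $$ (a, j) else 0) \<in> R"
    "const_mat P * A * const_mat Q = four_block_mat (0\<^sub>m k l) B C D"
    "B \<in> carrier_mat k (n - l)" "C \<in> carrier_mat (n - k) l" "D \<in> carrier_mat (n - k) (n - l)"
    "k + l \<le> n"
    "k + l = n \<Longrightarrow> linear_pencil k B \<and> full_mat B \<and> linear_pencil l C \<and> full_mat C"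
proof -
  have A_carrier: "A \<in> carrier_mat n n" using A by (simp add: linear_pencil_def)
  have kn: "k \<le> n" and ln: "l \<le> n" using L R dim_le_of_coord_space by (auto simp: k_def l_def)
  obtain X X' where X: "X \<in> carrier_mat n n" "X' \<in> carrier_mat n n" "X * X' = 1\<^sub>m n" "X' * X = 1\<^sub>m n"
    "\<And>j. j < k \<Longrightarrow> (\<lambda>i. if i < n then X $$ (i, j) else 0) \<in> L"
    by (rule adapted_basis_matrix[OF L, folded k_def]) (rule that)
  obtain Q Q' where Q: "Q \<in> carrier_mat n n" "Q' \<in> carrier_mat n n" "Q * Q' = 1\<^sub>m n" "Q' * Q = 1\<^sub>m n"
    "\<And>j. j < l \<Longrightarrow> (\<lambda>i. if i < n then Q $$ (i, j) else 0) \<in> R"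
    by (rule adapted_basis_matrix[OF R, folded l_def]) (rule that)
  define P where "P = transpose_mat X"
  define P' where "P' = transpose_mat X'"
  have P: "P \<in> carrier_mat n n" "P' \<in> carrier_mat n n" using X by (auto simp: P_def P'_def)
  have "P' * P = transpose_mat (X * X')"
    unfolding P_def P'_def by (rule transpose_mult[OF X(1,2), symmetric])
  then have P'P: "P' * P = 1\<^sub>m n" by (simp add: X(3))
  have PL: "(\<lambda>a. if a < n then P $$ (i, a) else 0) \<in> L" if "i < k" for i
  proof -
    have "(\<lambda>a. if a < n then P $$ (i, a) else 0) = (\<lambda>a. if a < n then X $$ (a, i) else 0)"
      using that kn X(1) by (auto simp: P_def)
    then show ?thesis using X(5)[OF that] by simp
  qed
  define N where "N = const_mat P * A * const_mat Q"
  have N_carrier: "N \<in> carrier_mat n n" using P Q A_carrier by (auto simp: N_def)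
  have N_entry: "N $$ (i, j) = (\<Sum>c<n. \<Sum>d<n. const (P $$ (i, c)) * A $$ (c, d) * const (Q $$ (d, j)))"
    if "i < n" "j < n" for i j
    unfolding N_def by (rule index_const_mat_mult3[OF P(1) A_carrier Q(1) that])
  have N_zero: "N $$ (i, j) = 0" if "i < k" "j < l" for i j
  proof -
    let ?l = "\<lambda>a. if a < n then P $$ (i, a) else 0" and ?r = "\<lambda>a. if a < n then Q $$ (a, j) else 0"
    have "N $$ (i, j) = (\<Sum>c<n. \<Sum>d<n. const (?l c) * A $$ (c, d) * const (?r d))"
      using that kn ln by (subst N_entry) (auto intro!: sum.cong)
    also have "\<dots> = 0"
      using LR[unfolded annihilates_def, rule_format, OF PL[OF that(1)] Q(5)[OF that(2)]] by simp
    finally show ?thesis .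
  qed
  have N_deg: "length w \<le> 1" if "i < n" "j < n" "wcoeff (N $$ (i, j)) w \<noteq> 0" for i j w
  proof -
    have "(\<Sum>c<n. \<Sum>d<n. P $$ (i, c) * wcoeff (A $$ (c, d)) w * Q $$ (d, j)) \<noteq> 0"
      using that by (simp add: N_entry lookup_sum lookup_times_const lookup_const_times mult.assoc)
    then obtain c where c: "c < n" "(\<Sum>d<n. P $$ (i, c) * wcoeff (A $$ (c, d)) w * Q $$ (d, j)) \<noteq> 0"
      by (metis (no_types, lifting) lessThan_iff sum.not_neutral_contains_not_neutral)
    then obtain d where "d < n" "P $$ (i, c) * wcoeff (A $$ (c, d)) w * Q $$ (d, j) \<noteq> 0"
      by (metis (no_types, lifting) lessThan_iff sum.not_neutral_contains_not_neutral)
    then show ?thesis using A c by (auto simp: linear_pencil_iff)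
  qed
  define B where "B = mat k (n - l) (\<lambda>(i, j). N $$ (i, j + l))"
  define C where "C = mat (n - k) l (\<lambda>(i, j). N $$ (i + k, j))"
  define D where "D = mat (n - k) (n - l) (\<lambda>(i, j). N $$ (i + k, j + l))"
  have BCD: "B \<in> carrier_mat k (n - l)" "C \<in> carrier_mat (n - k) l" "D \<in> carrier_mat (n - k) (n - l)"
    by (auto simp: B_def C_def D_def)
  have N_block: "N = four_block_mat (0\<^sub>m k l) B C D"
    by (rule eq_matI) (use N_carrier kn ln N_zero in \<open>auto simp: B_def C_def D_def\<close>)
  have full': "full_mat (four_block_mat (0\<^sub>m k l) B C D)"
    unfolding N_block[symmetric] N_def
  proof (rule full_mat_equiv[OF A_carrier full])
    show "const_mat P' * const_mat P = (1\<^sub>m n :: ('k, 'x) free_algebra mat)"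
      unfolding const_mat_mult[OF P(2,1), symmetric] P'P by (rule const_mat_one)
    show "const_mat Q * const_mat Q' = (1\<^sub>m n :: ('k, 'x) free_algebra mat)"
      unfolding const_mat_mult[OF Q(1,2), symmetric] Q(3) by (rule const_mat_one)
  qed (use P Q in auto)
  have sizes: "k + (n - k) = n" "l + (n - l) = n" using kn ln by auto
  have "full_mat (four_block_mat (0\<^sub>m k l) B (1\<^sub>m (n - k) * C) D)" using full' BCD by simp
  from full_zero_block_lower[OF this BCD(1) one_carrier_mat BCD(2,3) sizes]
  have le: "k + l \<le> n" using kn ln by linarith
  have pencils: "linear_pencil k B \<and> full_mat B \<and> linear_pencil l C \<and> full_mat C" if kl: "k + l = n"
  proof (intro conjI)
    have nl: "n - l = k" "n - k = l" using kl by auto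
    note BCD' = BCD[unfolded nl]
    show "linear_pencil k B"
      unfolding linear_pencil_iff
    proof (intro conjI allI impI)
      fix i j w assume "i < k" "j < k" "wcoeff (B $$ (i, j)) w \<noteq> 0"
      then show "length w \<le> 1" using N_deg[of i "j + l" w] kl by (simp add: B_def nl)
    qed (use BCD' in auto)
    show "linear_pencil l C"
      unfolding linear_pencil_iff
    proof (intro conjI allI impI)
      fix i j w assume "i < l" "j < l" "wcoeff (C $$ (i, j)) w \<noteq> 0"
      then show "length w \<le> 1" using N_deg[of "i + k" j w] kl by (simp add: C_def nl)
    qed (use BCD' in auto)
    show "full_mat B"
      unfolding full_mat_def
    proof (intro conjI notI)
      assume "\<exists>m<dim_row B. \<exists>T\<in>carrier_mat (dim_row B) m. \<exists>U\<in>carrier_mat m (dim_row B). B = T * U"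
      then obtain m T U where m: "m < k" "T \<in> carrier_mat k m" "U \<in> carrier_mat m k" "B = T * U"
        using BCD' by auto
      from full_zero_block_upper[OF full'[unfolded m(4)] BCD'(2) m(2,3) BCD'(3)] m(1) kl
      show False by auto
    qed (use BCD' in auto)
    show "full_mat C"
      unfolding full_mat_def
    proof (intro conjI notI)
      assume "\<exists>m<dim_row C. \<exists>T\<in>carrier_mat (dim_row C) m. \<exists>U\<in>carrier_mat m (dim_row C). C = T * U"
      then obtain m T U where m: "m < l" "T \<in> carrier_mat l m" "U \<in> carrier_mat m l" "C = T * U"
        using BCD' by auto
      from full_zero_block_lower[OF full'[unfolded m(4)] BCD'(1) m(2,3) BCD'(3)] m(1) kl
      show False by auto
    qed (use BCD' in auto)
  qed
  show thesis
  proof (rule that[of P P' Q Q' B C D])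
    show "const_mat P * A * const_mat Q = four_block_mat (0\<^sub>m k l) B C D"
      using N_block unfolding N_def .
    show "linear_pencil k B \<and> full_mat B \<and> linear_pencil l C \<and> full_mat C" if "k + l = n"
      using that by (rule pencils)
  qed (fact P P'P Q PL BCD le)+
qed

section \<open>Evaluation in the free field\<close>

lemma free_field_semiring_hom:
  fixes \<iota> :: "('k::field, 'x) free_algebra \<Rightarrow> 'f::division_ring"
  assumes "free_field \<iota>"
  shows "semiring_hom \<iota>"
proof -
  have hom: "\<iota> \<in> Ring.ring_hom class_ring class_ring"
    using assms by (simp add: free_field_def universal_field_of_fractions_def epic_field_def)
  have add: "\<iota> (a + b) = \<iota> a + \<iota> b" for a b
    using ring_hom_add[OF hom, of a b] by simp
  have "\<iota> 0 + \<iota> 0 = \<iota> 0 + 0" using add[of 0 0] by simp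
  then have "\<iota> 0 = 0" by (rule add_left_imp_eq)
  then show ?thesis
    by unfold_locales (use add ring_hom_mult[OF hom] ring_hom_one[OF hom] in auto)
qed

lemma free_field_inverse:
  assumes ff: "free_field \<iota>" and A: "A \<in> carrier_mat n n" and full: "full_mat A"
  obtains X where "X \<in> carrier_mat n n" "map_mat \<iota> A * X = 1\<^sub>m n" "X * map_mat \<iota> A = 1\<^sub>m n"
proof -
  have "invertible_mat (map_mat \<iota> A)" using ff full A by (auto simp: free_field_def)
  then obtain X where X: "map_mat \<iota> A * X = 1\<^sub>m n" "X * map_mat \<iota> A = 1\<^sub>m (dim_row X)"
    using A by (auto simp: invertible_mat_def inverts_mat_def)
  have "dim_col X = n" using arg_cong[OF X(1), of dim_col] by simp
  moreover have "dim_row X = n" using arg_cong[OF X(2), of dim_col] A by simp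
  ultimately show thesis using X by (intro that[of X]) auto
qed

lemma map_const_mat_mult:
  fixes X Y :: "'k::field mat"
  assumes ff: "free_field \<iota>" and X: "X \<in> carrier_mat a b" and Y: "Y \<in> carrier_mat b c"
  shows "map_mat \<iota> (const_mat (X * Y)) = map_mat \<iota> (const_mat X) * map_mat \<iota> (const_mat Y)"
proof -
  interpret semiring_hom \<iota> using ff by (rule free_field_semiring_hom)
  show ?thesis unfolding const_mat_mult[OF X Y] using X Y by (intro mat_hom_mult) auto
qed

text \<open>If a linear representation evaluates to zero, then the column \<open>(A\<^sup>-\<^sup>1 v, -1)\<close> lies in the kernel of the bordered matrix. So
this matrix is singular over the free field, hence not full, and it factors through a space of dimension at
most \<open>n\<close>.\<close>

lemma zero_representation:
  fixes \<iota> :: "('k::field, 'x::finite) free_algebra \<Rightarrow> 'f::division_ring"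
  assumes ff: "free_field \<iota>"
    and A: "linear_pencil n A" and u: "u \<in> carrier_mat 1 n" and v: "v \<in> carrier_mat n 1"
    and B: "B \<in> carrier_mat n n" and AB: "map_mat \<iota> A * B = 1\<^sub>m n"
    and zero: "map_mat \<iota> (const_mat u) * B * map_mat \<iota> (const_mat v) = 0\<^sub>m 1 1"
  obtains L R where "fun_space.subspace L" "L \<subseteq> coord_space n"
    "fun_space.subspace R" "R \<subseteq> coord_space n"
    "n \<le> fun_space.dim L + fun_space.dim R" "annihilates n A L R"
    "\<forall>l\<in>L. (\<Sum>i<n. l i * v $$ (i, 0)) = 0" "\<forall>r\<in>R. (\<Sum>j<n. u $$ (0, j) * r j) = 0"
proof -
  interpret semiring_hom \<iota> using ff by (rule free_field_semiring_hom)
  have A_carrier: "A \<in> carrier_mat n n" using A by (simp add: linear_pencil_def)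
  define M where "M = four_block_mat A (const_mat v) (const_mat u) (0\<^sub>m 1 1)"
  define a where "a = map_mat \<iota> A"
  define y where "y = map_mat \<iota> (const_mat v)"
  define x where "x = map_mat \<iota> (const_mat u)"
  have car: "a \<in> carrier_mat n n" "y \<in> carrier_mat n 1" "x \<in> carrier_mat 1 n"
    using A_carrier u v by (auto simp: a_def x_def y_def)
  have M_carrier: "M \<in> carrier_mat (n + 1) (n + 1)" 
    unfolding M_def by (rule four_block_carrier_mat) (use A_carrier in auto)
  have M: "map_mat \<iota> M = four_block_mat a y x (0\<^sub>m 1 1)"
    unfolding M_def a_def x_def y_def
    by (subst map_four_block_mat[of _ n n _ 1 _ 1]) (use A_carrier u v in auto)
  have "\<not> full_mat M"
  proof
    assume "full_mat M"
    from free_field_inverse[OF ff M_carrier this] obtain X where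
      X: "X \<in> carrier_mat (n + 1) (n + 1)" "X * map_mat \<iota> M = 1\<^sub>m (n + 1)" by metis
    \<comment> \<open>The kernel vector, written as a block matrix with one column.\<close>
    define z where "z = four_block_mat (B * y) (0\<^sub>m n 0) (- 1\<^sub>m 1) (0\<^sub>m 1 0)"
    have z: "z \<in> carrier_mat (n + 1) 1"
      using B car four_block_carrier_mat[of "B * y" n 1 "0\<^sub>m 1 0" 1 0 "0\<^sub>m n 0" "- 1\<^sub>m 1"] by (simp add: z_def)
    have aBy: "a * (B * y) = y"
      using assoc_mult_mat[OF car(1) B car(2)] AB car by (simp add: a_def)
    have xBy: "x * (B * y) = 0\<^sub>m 1 1"
      using zero assoc_mult_mat[OF car(3) B car(2)] by (simp add: x_def y_def)
    have "map_mat \<iota> M * z = four_block_mat (a * (B * y) + y * (- 1\<^sub>m 1)) (a * 0\<^sub>m n 0 + y * 0\<^sub>m 1 0)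
        (x * (B * y) + 0\<^sub>m 1 1 * (- 1\<^sub>m 1)) (x * 0\<^sub>m n 0 + 0\<^sub>m 1 1 * 0\<^sub>m 1 0)"
      unfolding M z_def by (rule mult_four_block_mat) (use car B in auto)
    also have "\<dots> = 0\<^sub>m (n + 1) 1"
      unfolding aBy xBy using car by (intro eq_matI) (auto simp: scalar_prod_def)
    finally have "X * (map_mat \<iota> M * z) = 0\<^sub>m (n + 1) 1" using X by simp
    moreover have "map_mat \<iota> M \<in> carrier_mat (n + 1) (n + 1)" using M_carrier by simp
    then have "X * map_mat \<iota> M * z = X * (map_mat \<iota> M * z)" by (rule assoc_mult_mat[OF X(1) _ z])
    ultimately have "z = 0\<^sub>m (n + 1) 1" using X(2) z by simp
    moreover have "z $$ (n, 0) = - 1" using B car by (simp add: z_def)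
    ultimately show False by simp
  qed
  then obtain m T U where m: "m \<le> n" and TU: "T \<in> carrier_mat (n + 1) m" "U \<in> carrier_mat m (n + 1)"
    "M = T * U" using M_carrier unfolding full_mat_def by (auto simp: less_Suc_eq_le)
  from bordered_factorization[OF A u v TU(1,2) TU(3)[unfolded M_def]] m that show thesis by force
qed

lemma four_block_row:
  assumes "u1 \<in> carrier_mat 1 a" "u2 \<in> carrier_mat 1 b" "y1 \<in> carrier_mat a 1" "y2 \<in> carrier_mat b 1"
  shows "four_block_mat u1 u2 (0\<^sub>m 0 a) (0\<^sub>m 0 b) * four_block_mat y1 (0\<^sub>m a 0) y2 (0\<^sub>m b 0)
    = u1 * y1 + u2 * (y2 :: 'r::semiring_1 mat)"
  using assms by (subst mult_four_block_mat[OF assms(1,2) zero_carrier_mat zero_carrier_mat assms(3) zero_carrier_mat assms(4) zero_carrier_mat])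
    (auto intro!: eq_matI)

lemma linear_representationE:
  assumes "linear_representation \<iota> f n u A v"
  obtains B where "u \<in> carrier_mat 1 n" "v \<in> carrier_mat n 1" "linear_pencil n A" "A \<in> carrier_mat n n"
    "full_mat A" "B \<in> carrier_mat n n" "map_mat \<iota> A * B = 1\<^sub>m n" "B * map_mat \<iota> A = 1\<^sub>m n"
    "f = (map_mat \<iota> (const_mat u) * B * map_mat \<iota> (const_mat v)) $$ (0, 0)"
  using assms by (auto simp: linear_representation_def linear_pencil_def inverts_mat_def)

lemma linear_representationI:
  assumes ff: "free_field \<iota>" and "u \<in> carrier_mat 1 n" "v \<in> carrier_mat n 1" "linear_pencil n A"
    "full_mat A" "X \<in> carrier_mat n n" "map_mat \<iota> A * X = 1\<^sub>m n" "X * map_mat \<iota> A = 1\<^sub>m n"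
  shows "linear_representation \<iota> ((map_mat \<iota> (const_mat u) * X * map_mat \<iota> (const_mat v)) $$ (0, 0)) n u A v"
  using assms by (auto simp: linear_representation_def linear_pencil_def inverts_mat_def intro!: bexI[of _ X])

text \<open>In a basis adapted to \<open>L\<close> and \<open>R\<close> the pencil is \<open>[[0, B], [C, D]]\<close>, and \<open>B\<close> and \<open>C\<close> are invertible over the free field. If
\<open>L\<close> kills \<open>v\<close>, the right hand side of the system is \<open>(0, v2)\<close>. The solution is then \<open>(C\<^sup>-\<^sup>1 v2, 0)\<close>, and \<open>C\<close> alone represents
\<open>f\<close>. Dually, if \<open>R\<close> is killed by \<open>u\<close>, the row \<open>u A\<^sup>-\<^sup>1\<close> is \<open>(u2 B\<^sup>-\<^sup>1, 0)\<close>, and \<open>B\<close> alone represents \<open>f\<close>.\<close>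

lemma reduce_representation:
  fixes \<iota> :: "('k::field, 'x::finite) free_algebra \<Rightarrow> 'f::division_ring"
  assumes ff: "free_field \<iota>" and rep: "linear_representation \<iota> f n u A v"
    and L: "L \<subseteq> coord_space n" and R: "R \<subseteq> coord_space n" and LR: "annihilates n A L R"
    and dims: "fun_space.dim L + fun_space.dim R = n"
  shows "(\<forall>l\<in>L. (\<Sum>i<n. l i * v $$ (i, 0)) = 0) \<Longrightarrow>
      \<exists>u' A' v'. linear_representation \<iota> f (fun_space.dim R) u' A' v'"
    and "(\<forall>r\<in>R. (\<Sum>j<n. u $$ (0, j) * r j) = 0) \<Longrightarrow>
      \<exists>u' A' v'. linear_representation \<iota> f (fun_space.dim L) u' A' v'"
proof -
  interpret semiring_hom \<iota> using ff by (rule free_field_semiring_hom)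
  obtain Y where u: "u \<in> carrier_mat 1 n" and v: "v \<in> carrier_mat n 1" and A: "linear_pencil n A"
    and A_carrier: "A \<in> carrier_mat n n" and full: "full_mat A"
    and Y: "Y \<in> carrier_mat n n" "map_mat \<iota> A * Y = 1\<^sub>m n" "Y * map_mat \<iota> A = 1\<^sub>m n"
    and f: "f = (map_mat \<iota> (const_mat u) * Y * map_mat \<iota> (const_mat v)) $$ (0, 0)"
    using rep by (rule linear_representationE)
  define k where "k = fun_space.dim L"
  define l where "l = fun_space.dim R"
  have kl: "k + l = n" and nl: "n - l = k" "n - k = l" using dims by (auto simp: k_def l_def)
  obtain P P' Q Q' B C D where P: "P \<in> carrier_mat n n" "P' \<in> carrier_mat n n" "P' * P = 1\<^sub>m n"
    and Q: "Q \<in> carrier_mat n n" "Q' \<in> carrier_mat n n" "Q * Q' = 1\<^sub>m n"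
    and PL: "\<And>i. i < k \<Longrightarrow> (\<lambda>a. if a < n then P $$ (i, a) else 0) \<in> L"
    and QR: "\<And>j. j < l \<Longrightarrow> (\<lambda>a. if a < n then Q $$ (a, j) else 0) \<in> R"
    and block: "const_mat P * A * const_mat Q = four_block_mat (0\<^sub>m k l) B C D"
    and BCD: "B \<in> carrier_mat k k" "C \<in> carrier_mat l l" "D \<in> carrier_mat l k"
    and B: "linear_pencil k B" "full_mat B" and C: "linear_pencil l C" "full_mat C"
    by (rule annihilates_normal_form[OF A full L R LR, folded k_def l_def, unfolded nl]) (use kl in blast)
  define hat :: "'k mat \<Rightarrow> 'f mat" where "hat Z = map_mat \<iota> (const_mat Z)" for Z
  have hat_mult: "hat (Z * W) = hat Z * hat W" if "Z \<in> carrier_mat a b" "W \<in> carrier_mat b c" for Z W a b c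
    unfolding hat_def by (rule map_const_mat_mult[OF ff that])
  have hat_carrier: "hat Z \<in> carrier_mat a b" if "Z \<in> carrier_mat a b" for Z a b
    using that by (simp add: hat_def)
  have hat_one: "hat (1\<^sub>m a) = 1\<^sub>m a" for a by (simp add: hat_def const_mat_one mat_hom_one)
  have hat_zero: "hat (0\<^sub>m a b) = 0\<^sub>m a b" for a b
    unfolding hat_def by (rule eq_matI) (auto simp: const_0)
  have hat_block: "hat (four_block_mat W1 W2 W3 W4) = four_block_mat (hat W1) (hat W2) (hat W3) (hat W4)"
    if W: "W1 \<in> carrier_mat r1 c1" "W2 \<in> carrier_mat r1 c2" "W3 \<in> carrier_mat r2 c1" "W4 \<in> carrier_mat r2 c2"
    for W1 W2 W3 W4 r1 r2 c1 c2
    unfolding hat_def map_four_block_mat[OF W]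
    by (rule map_four_block_mat) (use W in auto)
  define a where "a = map_mat \<iota> A"
  have a: "a \<in> carrier_mat n n" using A_carrier by (simp add: a_def)
  note c = hat_carrier[OF P(1)] hat_carrier[OF P(2)] hat_carrier[OF Q(1)] hat_carrier[OF u] hat_carrier[OF v]
    hat_carrier[OF Q(2)]
  have N: "hat P * a * hat Q = four_block_mat (0\<^sub>m k l) (map_mat \<iota> B) (map_mat \<iota> C) (map_mat \<iota> D)"
  proof -
    have cPQ: "(const_mat P :: ('k, 'x) free_algebra mat) \<in> carrier_mat n n"
      "(const_mat Q :: ('k, 'x) free_algebra mat) \<in> carrier_mat n n" using P Q by auto
    have "hat P * a * hat Q = map_mat \<iota> (const_mat P * A * const_mat Q)"
      unfolding hat_def a_def mat_hom_mult[OF cPQ(1) A_carrier, symmetric]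
        mat_hom_mult[OF mult_carrier_mat[OF cPQ(1) A_carrier] cPQ(2), symmetric] ..
    also have "\<dots> = four_block_mat (map_mat \<iota> (0\<^sub>m k l)) (map_mat \<iota> B) (map_mat \<iota> C) (map_mat \<iota> D)"
      unfolding block by (rule map_four_block_mat) (use BCD in auto)
    also have "map_mat \<iota> (0\<^sub>m k l) = 0\<^sub>m k l" by (rule eq_matI) auto
    finally show ?thesis .
  qed
  have P'P: "hat P' * hat P = 1\<^sub>m n" using hat_mult[OF P(2,1)] P(3) by (simp add: hat_one)
  have QQ': "hat Q * hat Q' = 1\<^sub>m n" using hat_mult[OF Q(1,2)] Q(3) by (simp add: hat_one)
  define u1 where "u1 = mat 1 l (\<lambda>(i, j). (u * Q) $$ (i, j))"
  define u2 where "u2 = mat 1 k (\<lambda>(i, j). (u * Q) $$ (i, j + l))"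
  define v1 where "v1 = mat k 1 (\<lambda>(i, j). (P * v) $$ (i, j))"
  define v2 where "v2 = mat l 1 (\<lambda>(i, j). (P * v) $$ (i + k, j))"
  have uv: "u1 \<in> carrier_mat 1 l" "u2 \<in> carrier_mat 1 k" "v1 \<in> carrier_mat k 1" "v2 \<in> carrier_mat l 1"
    by (auto simp: u1_def u2_def v1_def v2_def)
  note cuv = uv[THEN hat_carrier]
  have uQ: "hat (u * Q) = four_block_mat (hat u1) (hat u2) (0\<^sub>m 0 l) (0\<^sub>m 0 k)"
  proof -
    have "u * Q = four_block_mat u1 u2 (0\<^sub>m 0 l) (0\<^sub>m 0 k)"
      by (rule eq_matI) (use u Q kl in \<open>auto simp: u1_def u2_def\<close>)
    moreover have "hat (four_block_mat u1 u2 (0\<^sub>m 0 l) (0\<^sub>m 0 k)) =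
        four_block_mat (hat u1) (hat u2) (hat (0\<^sub>m 0 l)) (hat (0\<^sub>m 0 k))"
      by (rule hat_block) (use uv in auto)
    ultimately show ?thesis by (simp add: hat_zero)
  qed
  have Pv: "hat (P * v) = four_block_mat (hat v1) (0\<^sub>m k 0) (hat v2) (0\<^sub>m l 0)"
  proof -
    have "P * v = four_block_mat v1 (0\<^sub>m k 0) v2 (0\<^sub>m l 0)"
      by (rule eq_matI) (use P v kl in \<open>auto simp: v1_def v2_def\<close>)
    moreover have "hat (four_block_mat v1 (0\<^sub>m k 0) v2 (0\<^sub>m l 0)) =
        four_block_mat (hat v1) (hat (0\<^sub>m k 0)) (hat v2) (hat (0\<^sub>m l 0))"
      by (rule hat_block) (use uv in auto)
    ultimately show ?thesis by (simp add: hat_zero)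
  qed
  {
    assume Lv: "\<forall>l\<in>L. (\<Sum>i<n. l i * v $$ (i, 0)) = 0"
    have v1: "v1 = 0\<^sub>m k 1"
    proof (rule eq_matI)
      fix i j assume ij: "i < dim_row (0\<^sub>m k 1 :: 'k mat)" "j < dim_col (0\<^sub>m k 1 :: 'k mat)"
      then have i: "i < k" by simp
      have "(P * v) $$ (i, 0) = (\<Sum>a<n. (\<lambda>a. if a < n then P $$ (i, a) else 0) a * v $$ (a, 0))"
        using P v i kl by (auto simp: scalar_prod_def atLeast0LessThan)
      then show "v1 $$ (i, j) = 0\<^sub>m k 1 $$ (i, j)"
        using ij Lv[rule_format, OF PL[OF i]] by (simp add: v1_def)
    qed (use uv in auto)
    obtain X where X: "X \<in> carrier_mat l l" "map_mat \<iota> C * X = 1\<^sub>m l" "X * map_mat \<iota> C = 1\<^sub>m l"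
      by (rule free_field_inverse[OF ff BCD(2) C(2)])
    define y where "y = four_block_mat (X * hat v2) (0\<^sub>m l 0) (0\<^sub>m k 1) (0\<^sub>m k 0)"
    have y: "y \<in> carrier_mat n 1"
      using four_block_carrier_mat[of "X * hat v2" l 1 "0\<^sub>m k 0" k 0 "0\<^sub>m l 0" "0\<^sub>m k 1"] X cuv kl
      by (simp add: y_def add.commute)
    have "hat P * a * hat Q * y = four_block_mat
        (0\<^sub>m k l * (X * hat v2) + map_mat \<iota> B * 0\<^sub>m k 1) (0\<^sub>m k l * 0\<^sub>m l 0 + map_mat \<iota> B * 0\<^sub>m k 0)
        (map_mat \<iota> C * (X * hat v2) + map_mat \<iota> D * 0\<^sub>m k 1) (map_mat \<iota> C * 0\<^sub>m l 0 + map_mat \<iota> D * 0\<^sub>m k 0)"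
      unfolding N y_def by (rule mult_four_block_mat) (use BCD X cuv in auto)
    also have "map_mat \<iota> C * (X * hat v2) = hat v2"
      using assoc_mult_mat[of "map_mat \<iota> C" l l X l "hat v2" 1] BCD X cuv by simp
    also have "four_block_mat
        (0\<^sub>m k l * (X * hat v2) + map_mat \<iota> B * 0\<^sub>m k 1) (0\<^sub>m k l * 0\<^sub>m l 0 + map_mat \<iota> B * 0\<^sub>m k 0)
        (hat v2 + map_mat \<iota> D * 0\<^sub>m k 1) (map_mat \<iota> C * 0\<^sub>m l 0 + map_mat \<iota> D * 0\<^sub>m k 0)
        = hat (P * v)"
      using BCD X cuv unfolding Pv v1 hat_zero by auto
    also have "\<dots> = hat P * hat v" by (rule hat_mult[OF P(1) v])
    finally have Ny: "hat P * a * hat Q * y = hat P * hat v" .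
    have Qy: "hat Q * y \<in> carrier_mat n 1" using c y by auto
    have cancel: "hat P' * (hat P * z) = z" if z: "z \<in> carrier_mat n 1" for z
      using assoc_mult_mat[OF c(2,1) z] P'P z by simp
    have "hat P * a * hat Q * y = hat P * (a * (hat Q * y))"
      using assoc_mult_mat[OF mult_carrier_mat[OF c(1) a] c(3) y] assoc_mult_mat[OF c(1) a Qy] by simp
    with Ny have "hat P' * (hat P * (a * (hat Q * y))) = hat P' * (hat P * hat v)" by simp
    then have aQy: "a * (hat Q * y) = hat v"
      using cancel[OF c(5)] cancel[OF mult_carrier_mat[OF a Qy]] by simp
    have "Y * hat v = Y * a * (hat Q * y)"
      unfolding aQy[symmetric] by (rule assoc_mult_mat[OF Y(1) a Qy, symmetric])
    also have "\<dots> = hat Q * y" unfolding a_def Y(3) by (rule left_mult_one_mat[OF Qy])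
    finally have "Y * hat v = hat Q * y" .
    then have "hat u * Y * hat v = hat u * (hat Q * y)"
      using assoc_mult_mat[OF c(4) Y(1) c(5)] by simp
    also have "\<dots> = hat (u * Q) * y"
      using assoc_mult_mat[OF c(4) c(3) y] hat_mult[OF u Q(1)] by simp
    also have "\<dots> = hat u1 * (X * hat v2) + hat u2 * 0\<^sub>m k 1"
      unfolding uQ y_def by (rule four_block_row) (use cuv X in auto)
    also have "\<dots> = hat u1 * X * hat v2"
      using assoc_mult_mat[OF cuv(1) X(1) cuv(4)] cuv X by simp
    finally have "f = (hat u1 * X * hat v2) $$ (0, 0)" using f by (simp add: hat_def)
    moreover have "linear_representation \<iota> ((hat u1 * X * hat v2) $$ (0, 0)) l u1 C v2"
      unfolding hat_def by (rule linear_representationI[OF ff uv(1,4) C X])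
    ultimately show "\<exists>u' A' v'. linear_representation \<iota> f (fun_space.dim R) u' A' v'"
      unfolding l_def by blast
  next
    assume uR: "\<forall>r\<in>R. (\<Sum>j<n. u $$ (0, j) * r j) = 0"
    have u1: "u1 = 0\<^sub>m 1 l"
    proof (rule eq_matI)
      fix i j assume ij: "i < dim_row (0\<^sub>m 1 l :: 'k mat)" "j < dim_col (0\<^sub>m 1 l :: 'k mat)"
      then have j: "j < l" by simp
      have "(u * Q) $$ (0, j) = (\<Sum>a<n. u $$ (0, a) * (\<lambda>a. if a < n then Q $$ (a, j) else 0) a)"
        using u Q j kl by (auto simp: scalar_prod_def atLeast0LessThan)
      then show "u1 $$ (i, j) = 0\<^sub>m 1 l $$ (i, j)"
        using ij uR[rule_format, OF QR[OF j]] by (simp add: u1_def)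
    qed (use uv in auto)
    obtain X where X: "X \<in> carrier_mat k k" "map_mat \<iota> B * X = 1\<^sub>m k" "X * map_mat \<iota> B = 1\<^sub>m k"
      by (rule free_field_inverse[OF ff BCD(1) B(2)])
    define t where "t = four_block_mat (hat u2 * X) (0\<^sub>m 1 l) (0\<^sub>m 0 k) (0\<^sub>m 0 l)"
    have t: "t \<in> carrier_mat 1 n"
      using four_block_carrier_mat[of "hat u2 * X" 1 k "0\<^sub>m 0 l" 0 l "0\<^sub>m 1 l" "0\<^sub>m 0 k"] X cuv kl
      by (simp add: t_def)
    have "t * (hat P * a * hat Q) = four_block_mat
        (hat u2 * X * 0\<^sub>m k l + 0\<^sub>m 1 l * map_mat \<iota> C) (hat u2 * X * map_mat \<iota> B + 0\<^sub>m 1 l * map_mat \<iota> D)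
        (0\<^sub>m 0 k * 0\<^sub>m k l + 0\<^sub>m 0 l * map_mat \<iota> C) (0\<^sub>m 0 k * map_mat \<iota> B + 0\<^sub>m 0 l * map_mat \<iota> D)"
      unfolding N t_def by (rule mult_four_block_mat) (use BCD X cuv in auto)
    also have "hat u2 * X * map_mat \<iota> B = hat u2"
      using assoc_mult_mat[of "hat u2" 1 k X k "map_mat \<iota> B" k] BCD X cuv by simp
    also have "four_block_mat
        (hat u2 * X * 0\<^sub>m k l + 0\<^sub>m 1 l * map_mat \<iota> C) (hat u2 + 0\<^sub>m 1 l * map_mat \<iota> D)
        (0\<^sub>m 0 k * 0\<^sub>m k l + 0\<^sub>m 0 l * map_mat \<iota> C) (0\<^sub>m 0 k * map_mat \<iota> B + 0\<^sub>m 0 l * map_mat \<iota> D)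
        = hat (u * Q)"
      using BCD X cuv unfolding uQ u1 hat_zero by auto
    also have "\<dots> = hat u * hat Q" by (rule hat_mult[OF u Q(1)])
    finally have tN: "t * (hat P * a * hat Q) = hat u * hat Q" .
    have tP: "t * hat P \<in> carrier_mat 1 n" using c t by auto
    have cancel: "z * hat Q * hat Q' = z" if z: "z \<in> carrier_mat 1 n" for z
      unfolding assoc_mult_mat[OF z c(3,6)] QQ' by (rule right_mult_one_mat[OF z])
    have "t * (hat P * a * hat Q) = t * hat P * a * hat Q"
      unfolding assoc_mult_mat[OF c(1) a c(3)]
      unfolding assoc_mult_mat[OF t c(1) a] assoc_mult_mat[OF t mult_carrier_mat[OF c(1) a] c(3)]
        assoc_mult_mat[OF c(1) a c(3)] ..
    with tN have "t * hat P * a * hat Q * hat Q' = hat u * hat Q * hat Q'" by simp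
    then have tPa: "t * hat P * a = hat u"
      unfolding cancel[OF c(4)] cancel[OF mult_carrier_mat[OF tP a]] .
    have "hat u * Y = t * hat P * (a * Y)"
      unfolding tPa[symmetric] by (rule assoc_mult_mat[OF tP a Y(1)])
    also have "\<dots> = t * hat P" unfolding a_def Y(2) by (rule right_mult_one_mat[OF tP])
    finally have "hat u * Y * hat v = t * hat P * hat v" by simp
    also have "\<dots> = t * hat (P * v)"
      unfolding hat_mult[OF P(1) v] by (rule assoc_mult_mat[OF t c(1) c(5)])
    also have "\<dots> = hat u2 * X * hat v1 + 0\<^sub>m 1 l * hat v2"
      unfolding Pv t_def by (rule four_block_row) (use cuv X in auto)
    also have "\<dots> = hat u2 * X * hat v1"
      using cuv X by simp
    finally have "f = (hat u2 * X * hat v1) $$ (0, 0)" using f by (simp add: hat_def)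
    moreover have "linear_representation \<iota> ((hat u2 * X * hat v1) $$ (0, 0)) k u2 B v1"
      unfolding hat_def by (rule linear_representationI[OF ff uv(2,3) B X])
    ultimately show "\<exists>u' A' v'. linear_representation \<iota> f (fun_space.dim L) u' A' v'"
      unfolding k_def by blast
  }
qed

section \<open>Comparing two minimal systems\<close>

lemma sum_lessThan_add: "(\<Sum>i<m + n. F i) = (\<Sum>i<m. F i) + (\<Sum>i<n. F (m + i) :: 'a::comm_monoid_add)" for n :: nat
  by (induction n) (auto simp: add.assoc)

text \<open>A vector of length \<open>2 n\<close> is a pair of vectors of length \<open>n\<close>, one for each of the two systems; these are its components.\<close>

definition head_coords :: "nat \<Rightarrow> (nat \<Rightarrow> 'k::field) \<Rightarrow> nat \<Rightarrow> 'k" where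
  "head_coords n x = (\<lambda>i. if i < n then x i else 0)"

definition tail_coords :: "nat \<Rightarrow> (nat \<Rightarrow> 'k::field) \<Rightarrow> nat \<Rightarrow> 'k" where
  "tail_coords n x = (\<lambda>i. if i < n then x (n + i) else 0)"

lemma coords_linear:
  "head_coords n (x + y) = head_coords n x + head_coords n y"
  "head_coords n (\<lambda>i. c * x i) = (\<lambda>i. c * head_coords n x i)"
  "tail_coords n (x + y) = tail_coords n x + tail_coords n y"
  "tail_coords n (\<lambda>i. c * x i) = (\<lambda>i. c * tail_coords n x i)"
  by (auto simp: head_coords_def tail_coords_def fun_eq_iff)

lemma coords_in_coord_space: "head_coords n ` V \<subseteq> coord_space n" "tail_coords n ` V \<subseteq> coord_space n"
  by (auto simp: head_coords_def tail_coords_def coord_space_def)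

lemma subspace_coords_image:
  assumes "fun_space.subspace V"
  shows "fun_space.subspace (head_coords n ` V)" "fun_space.subspace (tail_coords n ` V)"
proof -
  have img: "fun_space.subspace (f ` V)"
    if add: "\<And>x y. f (x + y) = f x + f y" and scale: "\<And>c x. f (\<lambda>i. c * x i) = (\<lambda>i. c * f x i)"
    for f :: "(nat \<Rightarrow> 'a) \<Rightarrow> nat \<Rightarrow> 'a"
  proof (rule fun_space.subspaceI)
    have "f 0 = 0" using add[of 0 0] by simp
    with imageI[OF fun_space.subspace_0[OF assms], of f] show "0 \<in> f ` V" by simp
  next
    fix x y assume "x \<in> f ` V" "y \<in> f ` V"
    then obtain a b where "a \<in> V" "b \<in> V" "x = f a" "y = f b" by auto
    then show "x + y \<in> f ` V"
      using imageI[OF fun_space.subspace_add[OF assms, of a b], of f] by (simp add: add)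
  next
    fix c x assume "x \<in> f ` V"
    then obtain a where "a \<in> V" "x = f a" by auto
    then show "(\<lambda>i. c * x i) \<in> f ` V"
      using imageI[OF fun_space.subspace_scale[OF assms, of a c], of f] by (simp add: scale)
  qed
  show "fun_space.subspace (head_coords n ` V)" "fun_space.subspace (tail_coords n ` V)"
    by (rule img; rule coords_linear)+
qed

lemma coords_eq_0:
  assumes "x \<in> coord_space (n + n)" "head_coords n x = 0" "tail_coords n x = 0"
  shows "x = 0"
proof
  fix i
  have h: "i < n \<Longrightarrow> x i = 0" using fun_cong[OF assms(2), of i] by (simp add: head_coords_def)
  have t: "i - n < n \<Longrightarrow> x (n + (i - n)) = 0" using fun_cong[OF assms(3), of "i - n"] by (simp add: tail_coords_def)
  show "x i = 0 i"
    using assms(1) h t by (cases "i < n"; cases "i < n + n") (auto simp: coord_space_def)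
qed

text \<open>Rank and nullity for the two projections.\<close>

lemma dim_split_coords:
  assumes V: "fun_space.subspace V" "V \<subseteq> coord_space (n + n)"
  shows "fun_space.dim V \<le>
      fun_space.dim (tail_coords n ` {x \<in> V. head_coords n x = 0}) + fun_space.dim (head_coords n ` V)"
    and "fun_space.dim V \<le>
      fun_space.dim (head_coords n ` {x \<in> V. tail_coords n x = 0}) + fun_space.dim (tail_coords n ` V)"
proof -
  have dim0: "fun_space.dim S = 0" if "S \<subseteq> {0}" for S :: "(nat \<Rightarrow> 'a) set"
    using fun_space.dim_le_card[of S "{}"] that by simp
  note 0 = fun_space.subspace_0[OF V(1)]
  note add = fun_space.subspace_add[OF V(1)]
  note scale = fun_space.subspace_scale[OF V(1)]
  have h0: "head_coords n 0 = 0" and t0: "tail_coords n 0 = 0"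
    by (auto simp: head_coords_def tail_coords_def fun_eq_iff)
  have ker_h: "fun_space.subspace {x \<in> V. head_coords n x = 0}"
    by (rule fun_space.subspaceI) (auto simp: 0 add scale coords_linear h0 fun_eq_iff)
  have ker_t: "fun_space.subspace {x \<in> V. tail_coords n x = 0}"
    by (rule fun_space.subspaceI) (auto simp: 0 add scale coords_linear t0 fun_eq_iff)
  have "fun_space.dim V \<le> fun_space.dim {x \<in> V. head_coords n x = 0} + fun_space.dim (head_coords n ` V)"
    by (rule rank_nullity_le[OF coords_linear(1,2) V coords_in_coord_space(1)])
  moreover have "fun_space.dim {x \<in> V. head_coords n x = 0} \<le>
      fun_space.dim {x \<in> {x \<in> V. head_coords n x = 0}. tail_coords n x = 0}
      + fun_space.dim (tail_coords n ` {x \<in> V. head_coords n x = 0})"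
    by (rule rank_nullity_le[OF coords_linear(3,4) ker_h _ coords_in_coord_space(2)]) (use V in auto)
  moreover have "fun_space.dim {x \<in> {x \<in> V. head_coords n x = 0}. tail_coords n x = 0} = 0"
    by (rule dim0) (use V(2) coords_eq_0 in blast)
  ultimately show "fun_space.dim V \<le>
      fun_space.dim (tail_coords n ` {x \<in> V. head_coords n x = 0}) + fun_space.dim (head_coords n ` V)"
    by linarith
  have "fun_space.dim V \<le> fun_space.dim {x \<in> V. tail_coords n x = 0} + fun_space.dim (tail_coords n ` V)"
    by (rule rank_nullity_le[OF coords_linear(3,4) V coords_in_coord_space(2)])
  moreover have "fun_space.dim {x \<in> V. tail_coords n x = 0} \<le>
      fun_space.dim {x \<in> {x \<in> V. tail_coords n x = 0}. head_coords n x = 0}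
      + fun_space.dim (head_coords n ` {x \<in> V. tail_coords n x = 0})"
    by (rule rank_nullity_le[OF coords_linear(1,2) ker_t _ coords_in_coord_space(1)]) (use V in auto)
  moreover have "fun_space.dim {x \<in> {x \<in> V. tail_coords n x = 0}. head_coords n x = 0} = 0"
    by (rule dim0) (use V(2) coords_eq_0 in blast)
  ultimately show "fun_space.dim V \<le>
      fun_space.dim (head_coords n ` {x \<in> V. tail_coords n x = 0}) + fun_space.dim (tail_coords n ` V)"
    by linarith
qed

lemma annihilates_dim_le:
  assumes "linear_pencil n A" "full_mat A" "L \<subseteq> coord_space n" "R \<subseteq> coord_space n" "annihilates n A L R"
  shows "fun_space.dim L + fun_space.dim R \<le> n"
  by (rule annihilates_normal_form[OF assms])

text \<open>The difference of the two representations, with block diagonal pencil, represents zero. This gives subspaces \<open>L\<close>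
and \<open>R\<close> of dimension at least \<open>2 n\<close> in total. Let \<open>L\<^sub>2\<close> consist of the \<open>l\<close> with \<open>(0, l) \<in> L\<close>, and \<open>R\<^sub>1\<close> of the \<open>r\<close> with
\<open>(r, 0) \<in> R\<close>. The pencil \<open>A2\<close> is annihilated by \<open>L\<^sub>2\<close> and the second projection of \<open>R\<close>, the pencil \<open>A1\<close> by the first projection of
\<open>L\<close> and \<open>R\<^sub>1\<close>. Fullness bounds each pair of dimensions by \<open>n\<close>, so both bounds are attained. Then each pair yields a
representation of \<open>f\<close>, whose dimension is that of one of the two projections, and minimality makes these projections
surjective. So \<open>L\<close> contains a vector \<open>(e\<^sub>i, t\<^sub>i)\<close> for every \<open>i\<close>, and \<open>R\<close> a vector \<open>(-q\<^sub>j, e\<^sub>j)\<close> for every \<open>j\<close>. The rows \<open>t\<^sub>i\<close> form \<open>T\<close>,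
the columns \<open>q\<^sub>j\<close> form \<open>Q\<close>, and the equations for \<open>L\<close> and \<open>R\<close>, applied to these vectors, are the equations for
\<open>T\<close> and \<open>Q\<close>.\<close>

lemma minimal_representations_morphism:
  fixes \<iota> :: "('k::field, 'x::finite) free_algebra \<Rightarrow> 'f::division_ring"
  assumes ff: "free_field \<iota>"
    and min1: "minimal_linear_representation \<iota> f n u1 A1 v1"
    and min2: "minimal_linear_representation \<iota> f n u2 A2 v2"
  obtains T Q where "T \<in> carrier_mat n n" "Q \<in> carrier_mat n n"
    "const_mat T * A2 = A1 * const_mat Q" "u1 * Q = u2" "T * v2 = v1"
proof -
  interpret semiring_hom \<iota> using ff by (rule free_field_semiring_hom)
  have rep1: "linear_representation \<iota> f n u1 A1 v1" and rep2: "linear_representation \<iota> f n u2 A2 v2"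
    and least: "\<And>m u A v. linear_representation \<iota> f m u A v \<Longrightarrow> n \<le> m"
    using min1 min2 by (auto simp: minimal_linear_representation_def)
  obtain B1 where u1: "u1 \<in> carrier_mat 1 n" and v1: "v1 \<in> carrier_mat n 1"
    and A1: "linear_pencil n A1" "A1 \<in> carrier_mat n n" "full_mat A1"
    and B1: "B1 \<in> carrier_mat n n" "map_mat \<iota> A1 * B1 = 1\<^sub>m n" "B1 * map_mat \<iota> A1 = 1\<^sub>m n"
    and f1: "f = (map_mat \<iota> (const_mat u1) * B1 * map_mat \<iota> (const_mat v1)) $$ (0, 0)"
    using rep1 by (rule linear_representationE)
  obtain B2 where u2: "u2 \<in> carrier_mat 1 n" and v2: "v2 \<in> carrier_mat n 1"
    and A2: "linear_pencil n A2" "A2 \<in> carrier_mat n n" "full_mat A2"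
    and B2: "B2 \<in> carrier_mat n n" "map_mat \<iota> A2 * B2 = 1\<^sub>m n" "B2 * map_mat \<iota> A2 = 1\<^sub>m n"
    and f2: "f = (map_mat \<iota> (const_mat u2) * B2 * map_mat \<iota> (const_mat v2)) $$ (0, 0)"
    using rep2 by (rule linear_representationE)
  define A where "A = four_block_mat A1 (0\<^sub>m n n) (0\<^sub>m n n) A2"
  define B where "B = four_block_mat B1 (0\<^sub>m n n) (0\<^sub>m n n) B2"
  define u where "u = four_block_mat u1 u2 (0\<^sub>m 0 n) (0\<^sub>m 0 n)"
  define v where "v = four_block_mat v1 (0\<^sub>m n 0) (- v2) (0\<^sub>m n 0)"
  have A_carrier: "A \<in> carrier_mat (n + n) (n + n)" and B: "B \<in> carrier_mat (n + n) (n + n)"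
    unfolding A_def B_def using A1 A2 B1 B2 by (auto intro: four_block_carrier_mat)
  have u: "u \<in> carrier_mat 1 (n + n)"
    using four_block_carrier_mat[of u1 1 n "0\<^sub>m 0 n" 0 n u2 "0\<^sub>m 0 n"] u1 by (simp add: u_def)
  have v: "v \<in> carrier_mat (n + n) 1"
    using four_block_carrier_mat[of v1 n 1 "0\<^sub>m n 0" n 0 "0\<^sub>m n 0" "- v2"] v1 by (simp add: v_def)
  have A: "linear_pencil (n + n) A"
    unfolding linear_pencil_iff
  proof (intro conjI allI impI A_carrier)
    fix i j w assume ij: "i < n + n" "j < n + n" and w: "wcoeff (A $$ (i, j)) w \<noteq> 0"
    have "A $$ (i, j) = (if i < n then if j < n then A1 $$ (i, j) else 0
        else if j < n then 0 else A2 $$ (i - n, j - n))"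
      using A1 A2 ij by (auto simp: A_def)
    note entry = this
    have deg1: "wcoeff (A1 $$ (i, j)) w \<noteq> 0 \<Longrightarrow> length w \<le> 1" if "i < n" "j < n"
      using A1(1)[unfolded linear_pencil_iff] that by blast
    have deg2: "wcoeff (A2 $$ (i - n, j - n)) w \<noteq> 0 \<Longrightarrow> length w \<le> 1" if "i - n < n" "j - n < n"
      using A2(1)[unfolded linear_pencil_iff] that by blast
    show "length w \<le> 1"
    proof (cases "i < n \<longleftrightarrow> j < n")
      case True
      then show ?thesis using w ij deg1 deg2 unfolding entry by (cases "i < n") auto
    next
      case False
      then show ?thesis using w unfolding entry by (auto split: if_splits)
    qed
  qed
  have iota_neg: "\<iota> (const (- c)) = - \<iota> (const c)" for c
  proof (rule minus_unique[symmetric])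
    have "\<iota> (const c) + \<iota> (const (- c)) = \<iota> (const (c + - c))" by (simp only: hom_add const_add)
    also have "\<dots> = 0" by (simp add: const_0)
    finally show "\<iota> (const c) + \<iota> (const (- c)) = 0" .
  qed
  define hat :: "'k mat \<Rightarrow> 'f mat" where "hat Z = map_mat \<iota> (const_mat Z)" for Z
  have hat_carrier: "hat Z \<in> carrier_mat a b" if "Z \<in> carrier_mat a b" for Z a b
    using that by (simp add: hat_def)
  have hat_zero: "hat (0\<^sub>m a b) = 0\<^sub>m a b" for a b
    unfolding hat_def by (rule eq_matI) (auto simp: const_0)
  have hat_block: "hat (four_block_mat W1 W2 W3 W4) = four_block_mat (hat W1) (hat W2) (hat W3) (hat W4)"
    if W: "W1 \<in> carrier_mat r1 c1" "W2 \<in> carrier_mat r1 c2" "W3 \<in> carrier_mat r2 c1" "W4 \<in> carrier_mat r2 c2"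
    for W1 W2 W3 W4 r1 r2 c1 c2
    unfolding hat_def map_four_block_mat[OF W]
    by (rule map_four_block_mat) (use W in auto)
  note c = hat_carrier[OF u1] hat_carrier[OF u2] hat_carrier[OF v1] hat_carrier[OF v2]
  have AB: "map_mat \<iota> A * B = 1\<^sub>m (n + n)"
  proof -
    have "map_mat \<iota> A = four_block_mat (map_mat \<iota> A1) (map_mat \<iota> (0\<^sub>m n n)) (map_mat \<iota> (0\<^sub>m n n)) (map_mat \<iota> A2)"
      unfolding A_def by (rule map_four_block_mat) (use A1 A2 in auto)
    also have "map_mat \<iota> (0\<^sub>m n n) = 0\<^sub>m n n" by (rule eq_matI) auto
    finally have "map_mat \<iota> A * B = four_block_mat
        (map_mat \<iota> A1 * B1 + 0\<^sub>m n n * 0\<^sub>m n n) (map_mat \<iota> A1 * 0\<^sub>m n n + 0\<^sub>m n n * B2)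
        (0\<^sub>m n n * B1 + map_mat \<iota> A2 * 0\<^sub>m n n) (0\<^sub>m n n * 0\<^sub>m n n + map_mat \<iota> A2 * B2)"
      unfolding B_def by (simp only:) (rule mult_four_block_mat, use A1 A2 B1 B2 in auto)
    also have "\<dots> = four_block_mat (1\<^sub>m n) (0\<^sub>m n n) (0\<^sub>m n n) (1\<^sub>m n)"
      using A1 A2 B1 B2 by simp
    finally show ?thesis by simp
  qed
  have zero: "hat u * B * hat v = 0\<^sub>m 1 1"
  proof -
    have hu: "hat u = four_block_mat (hat u1) (hat u2) (0\<^sub>m 0 n) (0\<^sub>m 0 n)"
      unfolding u_def hat_zero[symmetric] by (rule hat_block) (use u1 u2 in auto)
    have neg: "hat (- v2) = - hat v2"
      unfolding hat_def by (rule eq_matI) (use v2 in \<open>auto simp: iota_neg\<close>)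
    have hv: "hat v = four_block_mat (hat v1) (0\<^sub>m n 0) (- hat v2) (0\<^sub>m n 0)"
      unfolding v_def hat_zero[symmetric] neg[symmetric] by (rule hat_block) (use v1 v2 in auto)
    have Bv: "B * hat v = four_block_mat (B1 * hat v1) (0\<^sub>m n 0) (B2 * (- hat v2)) (0\<^sub>m n 0)"
    proof -
      have "B * hat v = four_block_mat
          (B1 * hat v1 + 0\<^sub>m n n * (- hat v2)) (B1 * 0\<^sub>m n 0 + 0\<^sub>m n n * 0\<^sub>m n 0)
          (0\<^sub>m n n * hat v1 + B2 * (- hat v2)) (0\<^sub>m n n * 0\<^sub>m n 0 + B2 * 0\<^sub>m n 0)"
        unfolding B_def hv by (rule mult_four_block_mat) (use B1 B2 c in auto)
      also have "B1 * hat v1 + 0\<^sub>m n n * (- hat v2) = B1 * hat v1"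
        using B1 c left_mult_zero_mat[of "- hat v2" n 1 n] by simp
      also have "0\<^sub>m n n * hat v1 + B2 * (- hat v2) = B2 * (- hat v2)"
        using B2 c left_mult_zero_mat[of "hat v1" n 1 n] by simp
      finally show ?thesis using B1 B2 by simp
    qed
    have "hat u * B * hat v = hat u * (B * hat v)"
      by (rule assoc_mult_mat[OF hat_carrier[OF u] B hat_carrier[OF v]])
    also have "\<dots> = hat u1 * (B1 * hat v1) + hat u2 * (B2 * (- hat v2))"
      unfolding Bv hu by (rule four_block_row) (use B1 B2 c in auto)
    also have "\<dots> = hat u1 * B1 * hat v1 + - (hat u2 * B2 * hat v2)"
      using assoc_mult_mat[OF c(1) B1(1) c(3)] assoc_mult_mat[OF c(2) B2(1) c(4)] B2 c by simp
    also have "\<dots> = 0\<^sub>m 1 1"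
      by (rule eq_matI) (use f1 f2 c in \<open>auto simp: hat_def simp del: assoc_mult_mat\<close>)
    finally show ?thesis .
  qed
  obtain L R where L: "fun_space.subspace L" "L \<subseteq> coord_space (n + n)"
    and R: "fun_space.subspace R" "R \<subseteq> coord_space (n + n)"
    and dims: "n + n \<le> fun_space.dim L + fun_space.dim R" and LR: "annihilates (n + n) A L R"
    and Lv: "\<forall>l\<in>L. (\<Sum>i<n + n. l i * v $$ (i, 0)) = 0"
    and Ru: "\<forall>r\<in>R. (\<Sum>j<n + n. u $$ (0, j) * r j) = 0"
    by (rule zero_representation[OF ff A u v B AB zero[unfolded hat_def]])
  have LR': "(\<Sum>i<n. \<Sum>j<n. const (l i) * A1 $$ (i, j) * const (r j))
      + (\<Sum>i<n. \<Sum>j<n. const (l (n + i)) * A2 $$ (i, j) * const (r (n + j))) = 0"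
    if "l \<in> L" "r \<in> R" for l r
  proof -
    have "(\<Sum>i<n + n. \<Sum>j<n + n. const (l i) * A $$ (i, j) * const (r j)) = 0"
      using LR that unfolding annihilates_def by blast
    then show ?thesis
      unfolding sum_lessThan_add using A1(2) A2(2) by (simp add: A_def sum.distrib)
  qed
  have Lv': "(\<Sum>i<n. l i * v1 $$ (i, 0)) = (\<Sum>i<n. l (n + i) * v2 $$ (i, 0))" if "l \<in> L" for l
    using Lv[rule_format, OF that] v1 v2 unfolding sum_lessThan_add
    by (simp add: v_def sum_negf)
  have Ru': "(\<Sum>j<n. u1 $$ (0, j) * r j) + (\<Sum>j<n. u2 $$ (0, j) * r (n + j)) = 0" if "r \<in> R" for r
    using Ru[rule_format, OF that] u1 u2 unfolding sum_lessThan_add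
    by (simp add: u_def)
  define L\<^sub>2 where "L\<^sub>2 = tail_coords n ` {l \<in> L. head_coords n l = 0}"
  define R\<^sub>1 where "R\<^sub>1 = head_coords n ` {r \<in> R. tail_coords n r = 0}"
  have sub: "L\<^sub>2 \<subseteq> coord_space n" "R\<^sub>1 \<subseteq> coord_space n"
    unfolding L\<^sub>2_def R\<^sub>1_def by (rule coords_in_coord_space)+
  have head0: "x i = 0" if "head_coords n x = 0" "i < n" for i and x :: "nat \<Rightarrow> 'k"
    using fun_cong[OF that(1), of i] that(2) by (simp add: head_coords_def)
  have tail0: "x (n + i) = 0" if "tail_coords n x = 0" "i < n" for i and x :: "nat \<Rightarrow> 'k"
    using fun_cong[OF that(1), of i] that(2) by (simp add: tail_coords_def)
  have ann2: "annihilates n A2 L\<^sub>2 (tail_coords n ` R)"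
    unfolding annihilates_def
  proof (intro ballI)
    fix l' r' assume "l' \<in> L\<^sub>2" "r' \<in> tail_coords n ` R"
    then obtain l r where lr: "l \<in> L" "head_coords n l = 0" "r \<in> R" "l' = tail_coords n l" "r' = tail_coords n r"
      by (auto simp: L\<^sub>2_def)
    have "(\<Sum>i<n. \<Sum>j<n. const (l i) * A1 $$ (i, j) * const (r j)) = 0"
      using lr(2) by (simp add: head0 const_0)
    with LR'[OF lr(1,3)] show "(\<Sum>i<n. \<Sum>j<n. const (l' i) * A2 $$ (i, j) * const (r' j)) = 0"
      by (simp add: lr(4,5) tail_coords_def)
  qed
  have ann1: "annihilates n A1 (head_coords n ` L) R\<^sub>1"
    unfolding annihilates_def
  proof (intro ballI)
    fix l' r' assume "l' \<in> head_coords n ` L" "r' \<in> R\<^sub>1"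
    then obtain l r where lr: "l \<in> L" "tail_coords n r = 0" "r \<in> R" "l' = head_coords n l" "r' = head_coords n r"
      by (auto simp: R\<^sub>1_def)
    have "(\<Sum>i<n. \<Sum>j<n. const (l (n + i)) * A2 $$ (i, j) * const (r (n + j))) = 0"
      using lr(2) by (simp add: tail0 const_0)
    with LR'[OF lr(1,3)] show "(\<Sum>i<n. \<Sum>j<n. const (l' i) * A1 $$ (i, j) * const (r' j)) = 0"
      by (simp add: lr(4,5) head_coords_def)
  qed
  have "fun_space.dim L \<le> fun_space.dim L\<^sub>2 + fun_space.dim (head_coords n ` L)"
    "fun_space.dim R \<le> fun_space.dim R\<^sub>1 + fun_space.dim (tail_coords n ` R)"
    unfolding L\<^sub>2_def R\<^sub>1_def by (rule dim_split_coords[OF L] dim_split_coords[OF R])+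
  moreover have "fun_space.dim L\<^sub>2 + fun_space.dim (tail_coords n ` R) \<le> n"
    by (rule annihilates_dim_le[OF A2(1,3) sub(1) coords_in_coord_space(2) ann2])
  moreover have "fun_space.dim (head_coords n ` L) + fun_space.dim R\<^sub>1 \<le> n"
    by (rule annihilates_dim_le[OF A1(1,3) coords_in_coord_space(1) sub(2) ann1])
  ultimately have dim2: "fun_space.dim L\<^sub>2 + fun_space.dim (tail_coords n ` R) = n"
    and dim1: "fun_space.dim (head_coords n ` L) + fun_space.dim R\<^sub>1 = n"
    using dims by linarith+
  have "\<exists>u' A' v'. linear_representation \<iota> f (fun_space.dim (tail_coords n ` R)) u' A' v'"
  proof (rule reduce_representation(1)[OF ff rep2 sub(1) coords_in_coord_space(2) ann2 dim2], intro ballI)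
    fix l' assume "l' \<in> L\<^sub>2"
    then obtain l where l: "l \<in> L" "head_coords n l = 0" "l' = tail_coords n l" by (auto simp: L\<^sub>2_def)
    show "(\<Sum>i<n. l' i * v2 $$ (i, 0)) = 0"
      using Lv'[OF l(1)] l(2) by (simp add: l(3) tail_coords_def head0)
  qed
  then have "n \<le> fun_space.dim (tail_coords n ` R)" using least by blast
  then have tail_R: "tail_coords n ` R = coord_space n"
    by (rule eq_coord_space[OF subspace_coords_image(2)[OF R(1)] coords_in_coord_space(2)])
  have "\<exists>u' A' v'. linear_representation \<iota> f (fun_space.dim (head_coords n ` L)) u' A' v'"
  proof (rule reduce_representation(2)[OF ff rep1 coords_in_coord_space(1) sub(2) ann1 dim1], intro ballI)
    fix r' assume "r' \<in> R\<^sub>1"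
    then obtain r where r: "r \<in> R" "tail_coords n r = 0" "r' = head_coords n r" by (auto simp: R\<^sub>1_def)
    show "(\<Sum>j<n. u1 $$ (0, j) * r' j) = 0"
      using Ru'[OF r(1)] r(2) by (simp add: r(3) head_coords_def tail0)
  qed
  then have "n \<le> fun_space.dim (head_coords n ` L)" using least by blast
  then have head_L: "head_coords n ` L = coord_space n"
    by (rule eq_coord_space[OF subspace_coords_image(1)[OF L(1)] coords_in_coord_space(1)])
  have unit: "unit_fun i \<in> coord_space n" if "i < n" for i
    using that by (auto simp: unit_fun_def coord_space_def)
  have "\<forall>i\<in>{..<n}. \<exists>l. l \<in> L \<and> head_coords n l = unit_fun i"
  proof
    fix i assume "i \<in> {..<n}"
    then have "unit_fun i \<in> head_coords n ` L" unfolding head_L by (intro unit) simp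
    then show "\<exists>l. l \<in> L \<and> head_coords n l = unit_fun i" by auto
  qed
  from bchoice[OF this] obtain l where l: "\<And>i. i < n \<Longrightarrow> l i \<in> L \<and> head_coords n (l i) = unit_fun i"
    by blast
  have "\<forall>j\<in>{..<n}. \<exists>r. r \<in> R \<and> tail_coords n r = unit_fun j"
  proof
    fix j assume "j \<in> {..<n}"
    then have "unit_fun j \<in> tail_coords n ` R" unfolding tail_R by (intro unit) simp
    then show "\<exists>r. r \<in> R \<and> tail_coords n r = unit_fun j" by auto
  qed
  from bchoice[OF this] obtain r where r: "\<And>j. j < n \<Longrightarrow> r j \<in> R \<and> tail_coords n (r j) = unit_fun j"
    by blast
  have l_head: "l i a = unit_fun i a" if "i < n" "a < n" for i a
    using fun_cong[OF conjunct2[OF l[OF that(1)]], of a] that(2) by (simp add: head_coords_def)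
  have r_tail: "r j (n + a) = unit_fun j a" if "j < n" "a < n" for j a
    using fun_cong[OF conjunct2[OF r[OF that(1)]], of a] that(2) by (simp add: tail_coords_def)
  have pick: "(\<Sum>a<n. unit_fun i a * g a) = g i" if "i < n" for i and g :: "nat \<Rightarrow> 'k"
    using that by (simp add: unit_fun_def if_distrib[of "\<lambda>z. z * _"] cong: if_cong)
  have pick': "(\<Sum>a<n. const (unit_fun i a) * g a) = g i" "(\<Sum>a<n. g a * const (unit_fun i a)) = g i"
    if "i < n" for i and g :: "nat \<Rightarrow> ('k, 'x) free_algebra"
    using that by (simp_all add: unit_fun_def const_0 const_1 if_distrib[of const]
        if_distrib[of "\<lambda>z. z * _"] if_distrib[of "\<lambda>z. _ * z"] cong: if_cong)
  define T where "T = mat n n (\<lambda>(i, a). l i (n + a))"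
  define Q where "Q = mat n n (\<lambda>(b, j). - r j b)"
  have TQ: "T \<in> carrier_mat n n" "Q \<in> carrier_mat n n" by (auto simp: T_def Q_def)
  have "const_mat T * A2 = A1 * const_mat Q"
  proof (rule eq_matI)
    fix i j assume "i < dim_row (A1 * const_mat Q)" "j < dim_col (A1 * const_mat Q)"
    then have ij: "i < n" "j < n" using A1(2) TQ by auto
    have "(\<Sum>a<n. \<Sum>b<n. const (l i a) * A1 $$ (a, b) * const (r j b)) =
        (\<Sum>a<n. const (unit_fun i a) * (\<Sum>b<n. A1 $$ (a, b) * const (r j b)))"
      using ij by (intro sum.cong) (simp_all add: l_head sum_distrib_left mult.assoc)
    also have "\<dots> = (\<Sum>b<n. A1 $$ (i, b) * const (r j b))" by (rule pick'(1)[OF ij(1)])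
    finally have 1: "(\<Sum>a<n. \<Sum>b<n. const (l i a) * A1 $$ (a, b) * const (r j b)) =
      (\<Sum>b<n. A1 $$ (i, b) * const (r j b))" .
    have "(\<Sum>a<n. \<Sum>b<n. const (l i (n + a)) * A2 $$ (a, b) * const (r j (n + b))) =
        (\<Sum>a<n. const (l i (n + a)) * A2 $$ (a, j))"
      using ij by (intro sum.cong) (simp_all add: r_tail pick'(2))
    with 1 LR'[of "l i" "r j"] l[OF ij(1)] r[OF ij(2)]
    have "(\<Sum>b<n. A1 $$ (i, b) * const (r j b)) + (\<Sum>a<n. const (l i (n + a)) * A2 $$ (a, j)) = 0"
      by simp
    then have "(\<Sum>a<n. const (l i (n + a)) * A2 $$ (a, j)) = - (\<Sum>b<n. A1 $$ (i, b) * const (r j b))"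
      by (simp add: eq_neg_iff_add_eq_0 add.commute)
    also have "\<dots> = (\<Sum>b<n. A1 $$ (i, b) * const (- r j b))"
      by (simp add: const_def single_uminus sum_negf)
    finally show "(const_mat T * A2) $$ (i, j) = (A1 * const_mat Q) $$ (i, j)"
      using ij A1(2) A2(2) by (simp add: T_def Q_def scalar_prod_def atLeast0LessThan)
  qed (use A1(2) A2(2) TQ in auto)
  moreover have "u1 * Q = u2"
  proof (rule eq_matI)
    fix i j assume "i < dim_row u2" "j < dim_col u2"
    then have i: "i = 0" and j: "j < n" using u2 by auto
    have "(\<Sum>b<n. u2 $$ (0, b) * r j (n + b)) = (\<Sum>b<n. unit_fun j b * u2 $$ (0, b))"
      using j by (intro sum.cong) (simp_all add: r_tail)
    with Ru'[of "r j"] r[OF j] pick[OF j] have "(\<Sum>b<n. u1 $$ (0, b) * r j b) + u2 $$ (0, j) = 0"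
      by simp
    then have "- (\<Sum>b<n. u1 $$ (0, b) * r j b) = u2 $$ (0, j)"
      by (rule minus_unique)
    then show "(u1 * Q) $$ (i, j) = u2 $$ (i, j)"
      using i j u1 by (simp add: Q_def scalar_prod_def atLeast0LessThan sum_negf)
  qed (use u1 u2 TQ in auto)
  moreover have "T * v2 = v1"
  proof (rule eq_matI)
    fix i j assume "i < dim_row v1" "j < dim_col v1"
    then have i: "i < n" and j: "j = 0" using v1 by auto
    have "(\<Sum>a<n. l i a * v1 $$ (a, 0)) = (\<Sum>a<n. unit_fun i a * v1 $$ (a, 0))"
      using i by (intro sum.cong) (simp_all add: l_head)
    with Lv'[of "l i"] l[OF i] pick[OF i] have "v1 $$ (i, 0) = (\<Sum>a<n. l i (n + a) * v2 $$ (a, 0))"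
      by simp
    then show "(T * v2) $$ (i, j) = v1 $$ (i, j)"
      using i j v2 by (simp add: T_def scalar_prod_def atLeast0LessThan)
  qed (use v1 v2 TQ in auto)
  ultimately show thesis using TQ that by blast
qed

text \<open>Over the free field \<open>T A2 = A1 Q\<close> becomes \<open>A1\<^sup>-\<^sup>1 T = Q A2\<^sup>-\<^sup>1\<close>, and therefore
\<open>u1 A1\<^sup>-\<^sup>1 v1 = u1 A1\<^sup>-\<^sup>1 T v2 = u1 Q A2\<^sup>-\<^sup>1 v2 = u2 A2\<^sup>-\<^sup>1 v2\<close>.\<close>

lemma morphism_imp_eq:
  fixes \<iota> :: "('k::field, 'x::finite) free_algebra \<Rightarrow> 'f::division_ring"
  assumes ff: "free_field \<iota>"
    and rep1: "linear_representation \<iota> f n u1 A1 v1" and rep2: "linear_representation \<iota> g n u2 A2 v2"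
    and T: "T \<in> carrier_mat n n" and Q: "Q \<in> carrier_mat n n"
    and TQ: "const_mat T * A2 = A1 * const_mat Q" and uQ: "u1 * Q = u2" and Tv: "T * v2 = v1"
  shows "f = g"
proof -
  interpret semiring_hom \<iota> using ff by (rule free_field_semiring_hom)
  obtain B1 where u1: "u1 \<in> carrier_mat 1 n" and A1: "A1 \<in> carrier_mat n n"
    and B1: "B1 \<in> carrier_mat n n" "B1 * map_mat \<iota> A1 = 1\<^sub>m n"
    and f: "f = (map_mat \<iota> (const_mat u1) * B1 * map_mat \<iota> (const_mat v1)) $$ (0, 0)"
    using rep1 by (rule linear_representationE)
  obtain B2 where v2: "v2 \<in> carrier_mat n 1" and A2: "A2 \<in> carrier_mat n n"
    and B2: "B2 \<in> carrier_mat n n" "map_mat \<iota> A2 * B2 = 1\<^sub>m n"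
    and g: "g = (map_mat \<iota> (const_mat u2) * B2 * map_mat \<iota> (const_mat v2)) $$ (0, 0)"
    using rep2 by (rule linear_representationE)
  define t q u v a1 a2 where d: "t = map_mat \<iota> (const_mat T)" "q = map_mat \<iota> (const_mat Q)"
    "u = map_mat \<iota> (const_mat u1)" "v = map_mat \<iota> (const_mat v2)"
    "a1 = map_mat \<iota> A1" "a2 = map_mat \<iota> A2"
  have c: "t \<in> carrier_mat n n" "q \<in> carrier_mat n n" "u \<in> carrier_mat 1 n" "v \<in> carrier_mat n 1"
    "a1 \<in> carrier_mat n n" "a2 \<in> carrier_mat n n"
    using T Q u1 v2 A1 A2 by (auto simp: d)
  have "map_mat \<iota> (const_mat T * A2) = t * a2" "map_mat \<iota> (A1 * const_mat Q) = a1 * q"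
    unfolding d by (rule mat_hom_mult; use T Q A1 A2 in simp)+
  with TQ have ta: "t * a2 = a1 * q" by simp
  have "B1 * t = B1 * (t * a2 * B2)"
    using B2 c by (simp add: d(6) assoc_mult_mat[of t n n a2 n B2 n])
  also have "\<dots> = q * B2"
    unfolding ta assoc_mult_mat[OF c(5,2) B2(1)]
      assoc_mult_mat[OF B1(1) c(5) mult_carrier_mat[OF c(2) B2(1)], symmetric]
    using B1 B2 c by (simp add: d(5))
  finally have Bt: "B1 * t = q * B2" .
  have "u * B1 * (t * v) = u * (B1 * t) * v"
    using assoc_mult_mat[OF mult_carrier_mat[OF c(3) B1(1)] c(1,4)] assoc_mult_mat[OF c(3) B1(1) c(1)] by simp
  also have "\<dots> = u * q * B2 * v"
    unfolding Bt assoc_mult_mat[OF c(3,2) B2(1)] ..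
  finally have "u * B1 * (t * v) = u * q * B2 * v" .
  moreover have "map_mat \<iota> (const_mat v1) = t * v"
    unfolding d Tv[symmetric] by (rule map_const_mat_mult[OF ff T v2])
  moreover have "map_mat \<iota> (const_mat u2) = u * q"
    unfolding d uQ[symmetric] by (rule map_const_mat_mult[OF ff u1 Q])
  ultimately show "f = g" using f g d by simp
qed

text \<open>The matrices \<open>U\<close> of the statement and \<open>Q\<close> of a morphism correspond to each other by \<open>Q = U + E\<close> with
\<open>E = u\<^sub>f\<^sup>T u\<^sub>g\<close>, since \<open>u\<^sub>f E = u\<^sub>g\<close>.\<close>

theorem theorem2p4:
  fixes \<iota> :: "('k::field, 'x::finite) free_algebra \<Rightarrow> 'f::division_ring"
    and f g :: 'f and n :: nat
    and u\<^sub>f u\<^sub>g v\<^sub>f v\<^sub>g :: "'k mat"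
    and A\<^sub>f A\<^sub>g :: "('k, 'x) free_algebra mat"
  assumes "free_field \<iota>"
    and "minimal_als \<iota> f n u\<^sub>f A\<^sub>f v\<^sub>f"
    and "minimal_als \<iota> g n u\<^sub>g A\<^sub>g v\<^sub>g"
  shows "f = g \<longleftrightarrow>
    (\<exists>T \<in> carrier_mat n n. \<exists>U \<in> carrier_mat n n.
       u\<^sub>f * U = 0\<^sub>m 1 n \<and>
       const_mat T * A\<^sub>g - A\<^sub>f * const_mat U = A\<^sub>f * const_mat (transpose_mat u\<^sub>f) * const_mat u\<^sub>g \<and>
       T * v\<^sub>g = v\<^sub>f)"
proof -
  have minf: "minimal_linear_representation \<iota> f n u\<^sub>f A\<^sub>f v\<^sub>f" and uf: "u\<^sub>f = e1_row n"
    and ming: "minimal_linear_representation \<iota> g n u\<^sub>g A\<^sub>g v\<^sub>g" and ug: "u\<^sub>g = e1_row n"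
    using assms(2,3) by (auto simp: minimal_als_def)
  have repf: "linear_representation \<iota> f n u\<^sub>f A\<^sub>f v\<^sub>f" and repg: "linear_representation \<iota> g n u\<^sub>g A\<^sub>g v\<^sub>g"
    using minf ming by (auto simp: minimal_linear_representation_def)
  have u: "u\<^sub>f \<in> carrier_mat 1 n" "u\<^sub>g \<in> carrier_mat 1 n" by (auto simp: uf ug e1_row_def)
  have A: "A\<^sub>f \<in> carrier_mat n n" "A\<^sub>g \<in> carrier_mat n n"
    using repf repg by (auto simp: linear_representation_def linear_pencil_def)
  define E where "E = transpose_mat u\<^sub>f * u\<^sub>g"
  have E: "E \<in> carrier_mat n n" using u by (simp add: E_def)
  \<comment> \<open>This holds for \<open>n = 0\<close> too, where \<open>u\<^sub>f u\<^sub>f\<^sup>T = 0\<close> but \<open>u\<^sub>g\<close> has no entries.\<close>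
  have uE: "u\<^sub>f * E = u\<^sub>g"
    by (rule eq_matI) (auto simp: E_def uf ug e1_row_def scalar_prod_def if_distrib[of "\<lambda>z. z * _"] cong: if_cong)
  have AE: "A\<^sub>f * const_mat (transpose_mat u\<^sub>f) * const_mat u\<^sub>g = A\<^sub>f * const_mat E"
    unfolding E_def const_mat_mult[OF transpose_carrier_mat[THEN iffD2, OF u(1)] u(2)]
    by (rule assoc_mult_mat) (use A u in auto)
  have const_add_mat: "const_mat (U + E) = const_mat U + const_mat E" if "U \<in> carrier_mat n n" for U
    by (rule eq_matI) (use that E in \<open>auto simp: const_add\<close>)
  have eqs: "const_mat T * A\<^sub>g - A\<^sub>f * const_mat U = A\<^sub>f * const_mat E \<longleftrightarrow>
      const_mat T * A\<^sub>g = A\<^sub>f * const_mat (U + E)"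
    if TU: "T \<in> carrier_mat n n" "U \<in> carrier_mat n n" for T U
  proof -
    have "A\<^sub>f * const_mat (U + E) = A\<^sub>f * const_mat U + A\<^sub>f * const_mat E"
      unfolding const_add_mat[OF TU(2)] by (rule mult_add_distrib_mat) (use A TU E in auto)
    moreover have "X - Y = Z \<longleftrightarrow> X = Y + Z"
      if "X \<in> carrier_mat n n" "Y \<in> carrier_mat n n" "Z \<in> carrier_mat n n"
      for X Y Z :: "('k, 'x) free_algebra mat"
      using that by (auto simp: mat_eq_iff algebra_simps)
    ultimately show ?thesis using A TU E by simp
  qed
  show ?thesis
    unfolding AE
  proof
    assume "f = g"
    then obtain T Q where T: "T \<in> carrier_mat n n" and Q: "Q \<in> carrier_mat n n"
      and TQ: "const_mat T * A\<^sub>g = A\<^sub>f * const_mat Q" "u\<^sub>f * Q = u\<^sub>g" "T * v\<^sub>g = v\<^sub>f"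
      using minimal_representations_morphism[OF assms(1) minf] ming by metis
    have QE: "(Q - E) + E = Q" by (rule eq_matI) (use Q E in auto)
    have U: "Q - E \<in> carrier_mat n n" using E by (rule minus_carrier_mat)
    have "u\<^sub>f * (Q - E) = u\<^sub>g - u\<^sub>g"
      using mult_minus_distrib_mat[OF u(1) Q E] TQ uE by simp
    then have "u\<^sub>f * (Q - E) = 0\<^sub>m 1 n" using u by simp
    then show "\<exists>T \<in> carrier_mat n n. \<exists>U \<in> carrier_mat n n. u\<^sub>f * U = 0\<^sub>m 1 n \<and>
        const_mat T * A\<^sub>g - A\<^sub>f * const_mat U = A\<^sub>f * const_mat E \<and> T * v\<^sub>g = v\<^sub>f"
      using T U TQ eqs[OF T U] QE by metis
  next
    assume "\<exists>T \<in> carrier_mat n n. \<exists>U \<in> carrier_mat n n. u\<^sub>f * U = 0\<^sub>m 1 n \<and>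
        const_mat T * A\<^sub>g - A\<^sub>f * const_mat U = A\<^sub>f * const_mat E \<and> T * v\<^sub>g = v\<^sub>f"
    then obtain T U where T: "T \<in> carrier_mat n n" and U: "U \<in> carrier_mat n n"
      and uU: "u\<^sub>f * U = 0\<^sub>m 1 n" and TU: "const_mat T * A\<^sub>g = A\<^sub>f * const_mat (U + E)" and Tv: "T * v\<^sub>g = v\<^sub>f"
      using eqs by blast
    have uUE: "u\<^sub>f * (U + E) = u\<^sub>g"
      using mult_add_distrib_mat[OF u(1) U E] uU uE u by simp
    show "f = g"
      by (rule morphism_imp_eq[OF assms(1) repf repg T _ TU uUE Tv]) (use U E in auto)
  qed
qed

end
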